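(* Let $k$ be a field of characteristic $p>0$ and let $R$ be an $\mathbb{N}$-graded Noetherian ring with $R_0=k$ and Krull dimension $d$. Let $I$ be an ideal generated by a homogeneous system of parameters of $R$ of degrees $\delta_1,\delta_2,\dots,\delta_d$. Denote the Hilbert-Samuel multiplicity of $R$ by $e_R$. Then $$F(R,R,I)(y)=e_R\prod_{j=1}^{d}\left(\frac{1-e^{-i\delta_jy}}{iy}\right)$$ for all complex $y$, where each factor is extended analytically to $y=0$.
   Context: A homogeneous system of parameters of $R$ is a collection of homogeneous elements $f_1,\dots,f_d$, $d=\dim R$, with $R/(f_1,\dots,f_d)$ of finite length. $e_R=d!\lim_{n\to\infty}\frac{1}{n^d}\sum_{j\le n}\lambda(R_j)$. $I^{[p^n]}$ is the ideal generated by $p^n$-th powers of elements of $I$; $\lambda$ is length over $k$; $(\cdot)_j$ is the degree $j$ piece; $i$ is a fixed square root of $-1$. The Frobenius-Poincaré function is the entire function $$F(R,R,I)(y)=\lim_{n\to\infty}\left(\frac{1}{p^n}\right)^{\dim R}\sum_{j\in\mathbb{Z}}\lambda\left(\left(\frac{R}{I^{[p^n]}}\right)_j\right)e^{-iyj/p^n},$$ where the limit exists for all $y\in\mathbb{C}$. *)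

theory Defs
  imports "HOL-Algebra.Algebra" "HOL-Complex_Analysis.Complex_Analysis"
begin

text \<open>The supremum of all \<open>n\<close> for which there is a strictly increasing chain
  \<open>C 0 \<subset> C 1 \<subset> \<dots> \<subset> C n\<close> of members of \<open>S\<close>.\<close>

definition chain_height :: "'a set set \<Rightarrow> enat" where
  "chain_height S =
     Sup {enat n | n. \<exists>C. (\<forall>i\<le>n. C i \<in> S) \<and> (\<forall>i<n. C i \<subset> C (Suc i))}"

definition krull_dim :: "('a, 'm) ring_scheme \<Rightarrow> enat" where
  "krull_dim R = chain_height {P. primeideal P R}"

definition module_length :: "('r, 'm) ring_scheme \<Rightarrow> ('r, 'a, 'n) module_scheme \<Rightarrow> enat" where
  "module_length R M = chain_height {N. submodule N R M}"

text \<open>The additive order of \<open>\<one>\<close>; \<open>group.ord\<close> is \<open>0\<close> on elements of infinite order.\<close>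

definition ring_char :: "('a, 'm) ring_scheme \<Rightarrow> nat" where
  "ring_char R = group.ord (add_monoid R) \<one>\<^bsub>R\<^esub>"

text \<open>Uniqueness of the family \<open>c\<close> expresses that the sum of the \<open>A n\<close> is direct.\<close>

locale nat_graded_ring = cring R for R (structure) +
  fixes A :: "nat \<Rightarrow> 'a set"
  assumes piece_subgroup: "additive_subgroup (A n) R"
    and piece_mult: "\<lbrakk>x \<in> A m; y \<in> A n\<rbrakk> \<Longrightarrow> x \<otimes> y \<in> A (m + n)"
    and piece_decomp: "x \<in> carrier R \<Longrightarrow>
      \<exists>!c. (\<forall>n. c n \<in> A n) \<and> finite {n. c n \<noteq> \<zero>} \<and> x = (\<Oplus>n\<in>{n. c n \<noteq> \<zero>}. c n)"

definition degree_zero_ring :: "('a, 'm) ring_scheme \<Rightarrow> (nat \<Rightarrow> 'a set) \<Rightarrow> ('a, 'm) ring_scheme" where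
  "degree_zero_ring R A = R\<lparr>carrier := A 0\<rparr>"

text \<open>The additive group \<open>V\<close> inside the ring \<open>S\<close>, with scalars acting through \<open>s\<close>. The
  multiplicative fields are present only because module records extend ring records.\<close>

definition module_on :: "('a, 'm) ring_scheme \<Rightarrow> 'a set \<Rightarrow> ('r \<Rightarrow> 'a \<Rightarrow> 'a) \<Rightarrow> ('r, 'a) module" where
  "module_on S V s = \<lparr>carrier = V, monoid.mult = (\<otimes>\<^bsub>S\<^esub>), one = \<one>\<^bsub>S\<^esub>,
    ring.zero = \<zero>\<^bsub>S\<^esub>, add = (\<oplus>\<^bsub>S\<^esub>), module.smult = s\<rparr>"

definition quot_smult :: "('a, 'm) ring_scheme \<Rightarrow> 'a set \<Rightarrow> 'a \<Rightarrow> 'a set \<Rightarrow> 'a set" where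
  "quot_smult R I r c = (I +>\<^bsub>R\<^esub> r) \<otimes>\<^bsub>R Quot I\<^esub> c"

definition quot_module :: "('a, 'm) ring_scheme \<Rightarrow> 'a set \<Rightarrow> ('a, 'a set) module" where
  "quot_module R I = module_on (R Quot I) (carrier (R Quot I)) (quot_smult R I)"

text \<open>The homogeneous pieces \<open>R\<^sub>j\<close> and \<open>(R/I)\<^sub>j\<close>, the latter for a homogeneous ideal \<open>I\<close>,
  as modules over \<open>R\<^sub>0\<close>.\<close>

definition piece :: "('a, 'm) ring_scheme \<Rightarrow> (nat \<Rightarrow> 'a set) \<Rightarrow> nat \<Rightarrow> ('a, 'a) module" where
  "piece R A j = module_on R (A j) (\<otimes>\<^bsub>R\<^esub>)"

definition quot_piece ::
  "('a, 'm) ring_scheme \<Rightarrow> (nat \<Rightarrow> 'a set) \<Rightarrow> 'a set \<Rightarrow> nat \<Rightarrow> ('a, 'a set) module" where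
  "quot_piece R A I j = module_on (R Quot I) ((\<lambda>x. I +>\<^bsub>R\<^esub> x) ` A j) (quot_smult R I)"

definition homogeneous_sop ::
  "('a, 'm) ring_scheme \<Rightarrow> (nat \<Rightarrow> 'a set) \<Rightarrow> nat \<Rightarrow> (nat \<Rightarrow> 'a) \<Rightarrow> (nat \<Rightarrow> nat) \<Rightarrow> bool" where
  "homogeneous_sop R A d f \<delta> \<longleftrightarrow>
     krull_dim R = enat d \<and>
     (\<forall>j\<in>{1..d}. f j \<in> A (\<delta> j)) \<and>
     module_length R (quot_module R (Idl\<^bsub>R\<^esub> (f ` {1..d}))) \<noteq> \<infinity>"

definition frobenius_power :: "('a, 'm) ring_scheme \<Rightarrow> 'a set \<Rightarrow> nat \<Rightarrow> 'a set" where
  "frobenius_power R I q = Idl\<^bsub>R\<^esub> {x [^]\<^bsub>R\<^esub> q | x. x \<in> I}"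

definition hilbert_samuel_multiplicity :: "('a, 'm) ring_scheme \<Rightarrow> (nat \<Rightarrow> 'a set) \<Rightarrow> real" where
  "hilbert_samuel_multiplicity R A =
     (let d = the_enat (krull_dim R) in
      fact d * lim (\<lambda>n. 1 / real n ^ d *
        (\<Sum>j\<le>n. real (the_enat (module_length (degree_zero_ring R A) (piece R A j))))))"

text \<open>\<open>F(R,R,I)\<close>. Since \<open>R\<close> is graded by the naturals, the pieces of negative degree vanish and the
  sum over the integers is a sum over the naturals.\<close>

definition frobenius_poincare ::
  "('a, 'm) ring_scheme \<Rightarrow> (nat \<Rightarrow> 'a set) \<Rightarrow> nat \<Rightarrow> 'a set \<Rightarrow> complex \<Rightarrow> complex" where
  "frobenius_poincare R A p I y =
     lim (\<lambda>n. (1 / of_nat p ^ n) ^ the_enat (krull_dim R) *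
       suminf (\<lambda>j. of_nat (the_enat (module_length (degree_zero_ring R A)
                (quot_piece R A (frobenius_power R I (p ^ n)) j)))
             * exp (- \<i> * y * of_nat j / of_nat p ^ n)))"

end

theory Submission
  imports Defs "HOL-Library.Fun_Lexorder"
begin

text \<open>Write \<open>q = p^n\<close>. In characteristic \<open>p\<close> the Frobenius power \<open>I^[q]\<close> is generated by the
  powers \<open>f_i^q\<close> (lemma \<open>frobenius_power_generators\<close>), so the theorem is about the Hilbert functions of
  \<open>R/(f_1^q, \<dots>, f_d^q)\<close> as \<open>q\<close> grows. If \<open>R\<close> were a free module of rank \<open>r\<close> over the polynomial ring
  \<open>k[f_1, \<dots>, f_d]\<close>, on generators of degrees \<open>e_l\<close>, then this quotient would have a basis of elements
  \<open>f^b u_l\<close> with \<open>l < r\<close> and all \<open>b_i < q\<close>. The sum of its Hilbert function against \<open>exp (- \<i> y j / q)\<close>, divided by \<open>q^d\<close>,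
  would be a product of Riemann sums of \<open>exp (- \<i> y \<delta>_i t)\<close> on \<open>[0, 1]\<close> with limit
  \<open>r \<Prod> (1 - exp (- \<i> \<delta>_i y)) / (\<i> \<delta>_i y)\<close>, while counting lattice points in a simplex would give
  \<open>e_R = r / \<Prod> \<delta>_i\<close>. The proof shows that \<open>R\<close> always behaves like this, up to terms of order \<open>q^(d-1)\<close>.

  A graded form of Nakayama's lemma (\<open>graded_Nakayama\<close>) provides finitely many homogeneous \<open>u_l\<close> such
  that the \<open>f^b u_l\<close> span \<open>R\<close>. Fix a monomial order and call \<open>f^b u_l\<close> standard if it is not a combination
  of smaller ones of the same degree. Standard monomials form a basis of \<open>R\<close>, so they compute its Hilbert
  function, and for each \<open>l\<close> the exponents of standard monomials form a down-closed set, a staircase. A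
  staircase that is not everything is contained in finitely many slabs \<open>b_i < a_i\<close>, hence is of lower order;
  only the number \<open>r\<close> of full staircases matters. This gives \<open>e_R = r / \<Prod> \<delta>_i\<close> (\<open>sum_hilbert_limit\<close>).

  For the quotient, a standard monomial with some \<open>b_i \<ge> q\<close> lies in the ideal, so in each degree the number
  of standard monomials in the cube \<open>[0, q)^d\<close> is an upper bound for the Hilbert function. These bounds
  add up to \<open>r q^d + O(q^(d-1))\<close>. A matching lower bound \<open>r q^d\<close> for the total length comes from a tiling
  argument: Nakayama's lemma applied to the \<open>f_i^q\<close> covers \<open>R\<close> by translates of a basis of the quotient,
  and comparing growth rates yields the claim (\<open>tiling_lower_bound\<close>). As the upper bound holds degree by
  degree and the totals agree up to \<open>O(q^(d-1))\<close>, the sum of the absolute differences over all degrees is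
  \<open>O(q^(d-1))\<close>, so the quotient may be replaced by the free model in the limit
  (\<open>scaled_exponential_sum_limit\<close>).\<close>

section \<open>Exponent vectors and lattice points in simplices\<close>

text \<open>Exponent vectors are total functions that vanish off \<open>{1..d}\<close>; this makes addition pointwise and
  lets vectors of different length \<open>d\<close> share a type.\<close>

definition exponents :: "nat \<Rightarrow> (nat \<Rightarrow> nat) set" where
  "exponents d = {b. \<forall>i. i \<notin> {1..d} \<longrightarrow> b i = 0}"

definition weight :: "(nat \<Rightarrow> nat) \<Rightarrow> nat \<Rightarrow> (nat \<Rightarrow> nat) \<Rightarrow> nat" where
  "weight \<delta> d b = (\<Sum>i\<in>{1..d}. \<delta> i * b i)"

definition exponent_box :: "nat \<Rightarrow> (nat \<Rightarrow> nat) \<Rightarrow> (nat \<Rightarrow> nat) set" where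
  "exponent_box d c = {b \<in> exponents d. \<forall>i\<in>{1..d}. b i < c i}"

lemma exponents_0: "exponents 0 = {\<lambda>_. 0}"
  by (auto simp: exponents_def)

lemma exponents_Suc: "b(Suc d := k) \<in> exponents (Suc d)" if "b \<in> exponents d"
  using that by (auto simp: exponents_def)

lemma bij_betw_exponents_Suc: "bij_betw (\<lambda>(b, k). b(Suc d := k)) (exponents d \<times> UNIV) (exponents (Suc d))"
proof (rule bij_betw_byWitness[where f' = "\<lambda>b. (b(Suc d := 0), b (Suc d))"])
  show "(\<lambda>(b, k). b(Suc d := k)) ` (exponents d \<times> UNIV) \<subseteq> exponents (Suc d)"
    by (auto simp: exponents_Suc)
  show "(\<lambda>b. (b(Suc d := 0), b (Suc d))) ` exponents (Suc d) \<subseteq> exponents d \<times> UNIV"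
    by (auto simp: exponents_def)
qed (auto simp: exponents_def fun_eq_iff)

lemma weight_Suc: "weight \<delta> (Suc d) b = weight \<delta> d b + \<delta> (Suc d) * b (Suc d)"
  by (simp add: weight_def)

lemma weight_upd: "weight \<delta> d (b(Suc d := k)) = weight \<delta> d b"
  unfolding weight_def by (rule sum.cong) auto

lemma weight_add: "weight \<delta> d (\<lambda>i. b i + c i) = weight \<delta> d b + weight \<delta> d c"
  by (simp add: weight_def sum.distrib distrib_left)

lemma exponent_box_Suc: "exponent_box (Suc d) c = (\<lambda>(b, k). b(Suc d := k)) ` (exponent_box d c \<times> {..<c (Suc d)})"
proof (intro equalityI subsetI)
  fix b assume b: "b \<in> exponent_box (Suc d) c"
  then have "b = (\<lambda>(b, k). b(Suc d := k)) (b(Suc d := 0), b (Suc d))"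
    "(b(Suc d := 0), b (Suc d)) \<in> exponent_box d c \<times> {..<c (Suc d)}"
    by (auto simp: exponent_box_def exponents_def fun_eq_iff)
  then show "b \<in> (\<lambda>(b, k). b(Suc d := k)) ` (exponent_box d c \<times> {..<c (Suc d)})" by blast
qed (auto simp: exponent_box_def exponents_def le_Suc_eq)

lemma finite_exponent_box: "finite (exponent_box d c)"
proof (induction d)
  case 0 then show ?case by (simp add: exponent_box_def exponents_0)
next
  case (Suc d) then show ?case by (simp add: exponent_box_Suc)
qed

lemma sum_exponent_box:
  fixes g :: "nat \<Rightarrow> nat \<Rightarrow> 'a :: comm_semiring_1"
  shows "(\<Sum>b\<in>exponent_box d c. \<Prod>i\<in>{1..d}. g i (b i)) = (\<Prod>i\<in>{1..d}. \<Sum>k<c i. g i k)"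
proof (induction d)
  case 0 then show ?case by (simp add: exponent_box_def exponents_0)
next
  case (Suc d)
  have inj: "inj_on (\<lambda>(b, k). b(Suc d := k)) (exponent_box d c \<times> {..<c (Suc d)})"
    by (rule inj_on_subset[OF bij_betw_imp_inj_on[OF bij_betw_exponents_Suc]]) (auto simp: exponent_box_def)
  have upd: "(\<Prod>i\<in>{1..d}. g i ((b(Suc d := k)) i)) = (\<Prod>i\<in>{1..d}. g i (b i))" for b k
    by (rule prod.cong) auto
  have "(\<Sum>b\<in>exponent_box (Suc d) c. \<Prod>i\<in>{1..Suc d}. g i (b i)) =
      (\<Sum>(b,k)\<in>exponent_box d c \<times> {..<c (Suc d)}. (\<Prod>i\<in>{1..d}. g i (b i)) * g (Suc d) k)"
    unfolding exponent_box_Suc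
    by (subst sum.reindex[OF inj], rule sum.cong[OF refl]) (auto simp del: fun_upd_apply simp add: upd, auto)
  also have "\<dots> = (\<Sum>b\<in>exponent_box d c. \<Prod>i\<in>{1..d}. g i (b i)) * (\<Sum>k<c (Suc d). g (Suc d) k)"
    by (simp add: sum_product sum.cartesian_product)
  also have "\<dots> = (\<Prod>i\<in>{1..Suc d}. \<Sum>k<c i. g i k)"
    unfolding Suc by simp
  finally show ?case .
qed

lemma card_exponent_box: "card (exponent_box d c) = (\<Prod>i\<in>{1..d}. c i)"
  using sum_exponent_box[where g = "\<lambda>_ _. 1::nat" and d = d and c = c] by simp

definition lattice_count :: "(nat \<Rightarrow> nat) \<Rightarrow> nat \<Rightarrow> nat \<Rightarrow> nat" where
  "lattice_count \<delta> d n = card {b \<in> exponents d. weight \<delta> d b \<le> n}"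

lemma coord_le_weight:
  assumes "\<And>i. i \<in> {1..d} \<Longrightarrow> \<delta> i > 0" "i \<in> {1..d}"
  shows "b i \<le> weight \<delta> d b"
proof -
  have "b i \<le> \<delta> i * b i" using assms(1)[OF assms(2)] by (cases "\<delta> i") auto
  also have "\<dots> \<le> weight \<delta> d b"
    unfolding weight_def using assms(2) by (intro member_le_sum[where f="\<lambda>i. \<delta> i * b i"]) auto
  finally show ?thesis .
qed

lemma weight_le_subset_box:
  assumes "\<And>i. i \<in> {1..d} \<Longrightarrow> \<delta> i > 0"
  shows "{b \<in> exponents d. weight \<delta> d b \<le> n} \<subseteq> exponent_box d (\<lambda>_. Suc n)"
proof
  fix b assume b: "b \<in> {b \<in> exponents d. weight \<delta> d b \<le> n}"
  have "b i < Suc n" if "i \<in> {1..d}" for i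
    using coord_le_weight[of d \<delta> i b] assms that b by fastforce
  with b show "b \<in> exponent_box d (\<lambda>_. Suc n)" by (auto simp: exponent_box_def)
qed

lemma finite_weight_le:
  assumes "\<And>i. i \<in> {1..d} \<Longrightarrow> \<delta> i > 0"
  shows "finite {b \<in> exponents d. weight \<delta> d b \<le> n}"
  using weight_le_subset_box[of d \<delta> n] assms finite_exponent_box finite_subset by blast

text \<open>Splitting by whether the last coordinate vanishes gives a recursion in \<open>n\<close>: a vector with positive last
  coordinate is obtained from one of weight smaller by \<open>\<delta> (Suc d)\<close>.\<close>

lemma lattice_count_Suc:
  assumes "\<And>i. i \<in> {1..Suc d} \<Longrightarrow> \<delta> i > 0"
  shows "lattice_count \<delta> (Suc d) n = lattice_count \<delta> d n +
    (if \<delta> (Suc d) \<le> n then lattice_count \<delta> (Suc d) (n - \<delta> (Suc d)) else 0)"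
proof -
  let ?D = "\<delta> (Suc d)"
  let ?S = "\<lambda>n. {b \<in> exponents (Suc d). weight \<delta> (Suc d) b \<le> n}"
  let ?up = "\<lambda>b. b(Suc d := Suc (b (Suc d)))"
  have eq: "?S n = {b \<in> exponents d. weight \<delta> d b \<le> n} \<union> {b \<in> ?S n. b (Suc d) \<noteq> 0}"
  proof (intro equalityI subsetI)
    fix b assume b: "b \<in> ?S n"
    show "b \<in> {b \<in> exponents d. weight \<delta> d b \<le> n} \<union> {b \<in> ?S n. b (Suc d) \<noteq> 0}"
    proof (cases "b (Suc d) = 0")
      case True
      then have "b \<in> exponents d" using b by (auto simp: exponents_def) (metis le_Suc_eq not_less_eq_eq)
      then show ?thesis using b by (auto simp: weight_Suc)
    qed (use b in auto)
  qed (auto simp: weight_Suc exponents_def)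
  have fin: "finite (?S n)" by (rule finite_weight_le) (use assms in auto)
  have D: "?D > 0" using assms by auto
  have im: "{b \<in> ?S n. b (Suc d) \<noteq> 0} = (if ?D \<le> n then ?up ` ?S (n - ?D) else {})"
  proof (intro equalityI subsetI)
    fix b assume b: "b \<in> {b \<in> ?S n. b (Suc d) \<noteq> 0}"
    let ?c = "b(Suc d := b (Suc d) - 1)"
    have bc: "b = ?up ?c" using b by (auto simp: fun_eq_iff)
    have "weight \<delta> (Suc d) b = weight \<delta> (Suc d) ?c + ?D"
      using b by (cases "b (Suc d)") (simp_all add: weight_Suc weight_upd)
    then have "?D \<le> n \<and> ?c \<in> ?S (n - ?D)" using b by (auto simp: exponents_def)
    then show "b \<in> (if ?D \<le> n then ?up ` ?S (n - ?D) else {})" using bc by (auto intro!: image_eqI[of _ _ ?c])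
  next
    fix b assume "b \<in> (if ?D \<le> n then ?up ` ?S (n - ?D) else {})"
    then show "b \<in> {b \<in> ?S n. b (Suc d) \<noteq> 0}"
      by (auto split: if_splits simp: weight_Suc weight_upd exponents_def)
  qed
  have "inj_on ?up A" for A
    by (rule inj_onI) (auto simp: fun_eq_iff split: if_splits)
  then have card_im: "card {b \<in> ?S n. b (Suc d) \<noteq> 0} = (if ?D \<le> n then lattice_count \<delta> (Suc d) (n - ?D) else 0)"
    unfolding im by (auto simp: card_image lattice_count_def)
  have "card (?S n) = card {b \<in> exponents d. weight \<delta> d b \<le> n} + card {b \<in> ?S n. b (Suc d) \<noteq> 0}"
    by (subst eq, rule card_Un_disjoint) (use fin eq in \<open>auto simp: exponents_def intro: finite_subset[OF _ fin]\<close>)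
  then show ?thesis using card_im by (simp add: lattice_count_def)
qed

text \<open>The mean value inequality for \<open>x^(d+1)\<close>, from which the two bounds below inherit their telescoping
  induction step.\<close>

lemma power_Suc_diff_bounds:
  fixes x y :: real
  assumes "0 \<le> y" "y \<le> x"
  shows "real (Suc d) * (x - y) * y ^ d \<le> x ^ Suc d - y ^ Suc d"
    and "x ^ Suc d - y ^ Suc d \<le> real (Suc d) * (x - y) * x ^ d"
proof -
  have eq: "x ^ Suc d - y ^ Suc d = (x - y) * (\<Sum>i<Suc d. y ^ (d - i) * x ^ i)"
    using diff_power_eq_sum[of x d y] by (simp add: mult.commute)
  have "(\<Sum>i<Suc d. y ^ (d - i) * x ^ i) \<ge> (\<Sum>i<Suc d. y ^ d)"
  proof (rule sum_mono)
    fix i assume "i \<in> {..<Suc d}"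
    then have "y ^ d = y ^ (d - i) * y ^ i" by (simp flip: power_add)
    also have "\<dots> \<le> y ^ (d - i) * x ^ i" using assms by (intro mult_left_mono power_mono) auto
    finally show "y ^ d \<le> y ^ (d - i) * x ^ i" .
  qed
  then have "(x - y) * (\<Sum>i<Suc d. y ^ d) \<le> (x - y) * (\<Sum>i<Suc d. y ^ (d - i) * x ^ i)"
    using assms by (intro mult_left_mono) auto
  then show "real (Suc d) * (x - y) * y ^ d \<le> x ^ Suc d - y ^ Suc d"
    unfolding eq by (simp add: algebra_simps)
  have "(\<Sum>i<Suc d. y ^ (d - i) * x ^ i) \<le> (\<Sum>i<Suc d. x ^ d)"
  proof (rule sum_mono)
    fix i assume "i \<in> {..<Suc d}"
    then have "x ^ d = x ^ (d - i) * x ^ i" by (simp flip: power_add)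
    moreover have "\<dots> \<ge> y ^ (d - i) * x ^ i" using assms by (intro mult_right_mono power_mono) auto
    ultimately show "y ^ (d - i) * x ^ i \<le> x ^ d" by simp
  qed
  then have "(x - y) * (\<Sum>i<Suc d. y ^ (d - i) * x ^ i) \<le> (x - y) * (\<Sum>i<Suc d. x ^ d)"
    using assms by (intro mult_left_mono) auto
  then show "x ^ Suc d - y ^ Suc d \<le> real (Suc d) * (x - y) * x ^ d"
    unfolding eq by (simp add: algebra_simps)
qed

text \<open>The count times \<open>\<Prod> \<delta>_i\<close> is the volume of the union of the boxes with sides \<open>\<delta>_i\<close> attached to the lattice
  points. This union contains the simplex of size \<open>n\<close> and is contained in the one of size \<open>n + \<Sum> \<delta>_i\<close>.
  The proof replaces volumes by the recursion for the count.\<close>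

lemma lattice_count_bounds:
  assumes "\<And>i. i \<in> {1..d} \<Longrightarrow> \<delta> i > 0"
  shows "real n ^ d \<le> real (lattice_count \<delta> d n) * (fact d * real (\<Prod>i\<in>{1..d}. \<delta> i))"
    and "real (lattice_count \<delta> d n) * (fact d * real (\<Prod>i\<in>{1..d}. \<delta> i)) \<le> real (n + (\<Sum>i\<in>{1..d}. \<delta> i)) ^ d"
proof -
  have "real n ^ d \<le> real (lattice_count \<delta> d n) * (fact d * real (\<Prod>i\<in>{1..d}. \<delta> i)) \<and>
    real (lattice_count \<delta> d n) * (fact d * real (\<Prod>i\<in>{1..d}. \<delta> i)) \<le> real (n + (\<Sum>i\<in>{1..d}. \<delta> i)) ^ d"
  using assms
proof (induction d arbitrary: n)
  case 0
  show ?case by (simp add: lattice_count_def exponents_0 weight_def)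
next
  case (Suc d)
  define D where "D = \<delta> (Suc d)"
  define s where "s = (\<Sum>i\<in>{1..d}. \<delta> i)"
  define P :: real where "P = fact d * real (\<Prod>i\<in>{1..d}. \<delta> i)"
  have P0: "P \<ge> 0" by (simp add: P_def prod_nonneg)
  have Q: "fact (Suc d) * real (\<Prod>i\<in>{1..Suc d}. \<delta> i) = P * (real (Suc d) * real D)"
    by (simp add: P_def D_def algebra_simps)
  have pos: "\<And>i. i \<in> {1..Suc d} \<Longrightarrow> \<delta> i > 0" using Suc.prems by blast
  have pos': "\<And>i. i \<in> {1..d} \<Longrightarrow> \<delta> i > 0" using pos by auto
  have Dpos: "D > 0" using pos by (simp add: D_def)
  have IH1: "real n ^ d \<le> real (lattice_count \<delta> d n) * P" for n
    using Suc.IH[OF pos'] by (simp add: P_def)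
  have IH2: "real (lattice_count \<delta> d n) * P \<le> real (n + s) ^ d" for n
    using Suc.IH[OF pos'] by (simp add: P_def s_def)
  note rec = lattice_count_Suc[of d \<delta>, OF pos, folded D_def]
  have lower: "real n ^ Suc d \<le> real (lattice_count \<delta> (Suc d) n) * (P * (real (Suc d) * real D))"
    proof (induction n rule: less_induct)
      case (less n)
      have A: "real (Suc d) * real D * real n ^ d \<le> real (Suc d) * real D * (real (lattice_count \<delta> d n) * P)"
        using IH1 by (intro mult_left_mono) auto
      show ?case
      proof (cases "D \<le> n")
        case True
        have "real n ^ Suc d \<le> real (n - D) ^ Suc d + real (Suc d) * real D * real n ^ d"
          using power_Suc_diff_bounds(2)[of "real (n - D)" "real n" d] True by (simp add: of_nat_diff)
        also have "\<dots> \<le> real (lattice_count \<delta> (Suc d) (n - D)) * (P * (real (Suc d) * real D))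
            + real (Suc d) * real D * (real (lattice_count \<delta> d n) * P)"
          using less[of "n - D"] Dpos True A by (intro add_mono) auto
        finally show ?thesis using True by (subst rec) (auto simp: algebra_simps)
      next
        case False
        have "real n ^ Suc d \<le> real (Suc d) * real D * real n ^ d"
        proof -
          have "real n \<le> real (Suc d) * real D" using False Dpos
            by (metis le_trans mult_le_mono1 nat_le_linear nat_mult_1 of_nat_le_iff of_nat_mult le_add1 plus_1_eq_Suc)
          then show ?thesis by (simp add: mult_right_mono)
        qed
        then show ?thesis using False A by (subst rec) (auto simp: algebra_simps)
      qed
    qed
  have upper: "real (lattice_count \<delta> (Suc d) n) * (P * (real (Suc d) * real D)) \<le> real (n + s + D) ^ Suc d"
    proof (induction n rule: less_induct)
      case (less n)
      have A: "real (Suc d) * real D * (real (lattice_count \<delta> d n) * P) \<le> real (Suc d) * real D * real (n + s) ^ d"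
        using IH2 by (intro mult_left_mono) auto
      have B: "real (Suc d) * real D * real (n + s) ^ d + real (n + s) ^ Suc d \<le> real (n + s + D) ^ Suc d"
        using power_Suc_diff_bounds(1)[of "real (n + s)" "real (n + s + D)" d] by simp
      show ?case
      proof (cases "D \<le> n")
        case True
        have "real (lattice_count \<delta> (Suc d) (n - D)) * (P * (real (Suc d) * real D)) \<le> real (n + s) ^ Suc d"
          using less[of "n - D"] Dpos True by (simp add: of_nat_diff)
        then show ?thesis using True A B by (subst rec) (auto simp: algebra_simps)
      next
        case False
        have "real (n + s) ^ Suc d \<ge> 0" by simp
        then have "real (Suc d) * real D * (real (lattice_count \<delta> d n) * P) \<le> real (n + s + D) ^ Suc d"
          using A B by linarith
        then show ?thesis using False by (subst rec) (auto simp: algebra_simps)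
      qed
    qed
  have "n + (\<Sum>i\<in>{1..Suc d}. \<delta> i) = n + s + D" by (simp add: s_def D_def)
  then show ?case using lower upper by (simp only: Q)
qed
  then show "real n ^ d \<le> real (lattice_count \<delta> d n) * (fact d * real (\<Prod>i\<in>{1..d}. \<delta> i))"
    and "real (lattice_count \<delta> d n) * (fact d * real (\<Prod>i\<in>{1..d}. \<delta> i)) \<le> real (n + (\<Sum>i\<in>{1..d}. \<delta> i)) ^ d"
    by blast+
qed

lemma power_shift_limit: "(\<lambda>n. (real (n + s) / real n) ^ d) \<longlonglongrightarrow> 1"
proof -
  have "(\<lambda>n. (1 + real s / real n) ^ d) \<longlonglongrightarrow> (1 + 0) ^ d"
    by (intro tendsto_intros lim_const_over_n)
  then have "(\<lambda>n. (1 + real s / real n) ^ d) \<longlonglongrightarrow> 1" by simp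
  then show ?thesis
    by (rule Lim_transform_eventually)
       (auto simp: field_simps intro!: eventually_mono[OF eventually_gt_at_top[of 0]])
qed

lemma lattice_count_limit:
  assumes "\<And>i. i \<in> {1..d} \<Longrightarrow> \<delta> i > 0"
  shows "(\<lambda>n. real (lattice_count \<delta> d n) / real n ^ d) \<longlonglongrightarrow> 1 / (fact d * real (\<Prod>i\<in>{1..d}. \<delta> i))"
proof -
  define P :: real where "P = fact d * real (\<Prod>i\<in>{1..d}. \<delta> i)"
  define s where "s = (\<Sum>i\<in>{1..d}. \<delta> i)"
  have P: "P > 0" using assms by (auto simp: P_def intro!: mult_pos_pos prod_pos)
  have "(\<lambda>n. (real (n + s) / real n) ^ d * (1 / P)) \<longlonglongrightarrow> 1 * (1 / P)"
    by (intro tendsto_intros power_shift_limit)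
  then have U: "(\<lambda>n. (real (n + s) / real n) ^ d / P) \<longlonglongrightarrow> 1 / P" by simp
  show ?thesis unfolding P_def[symmetric]
  proof (rule tendsto_sandwich[OF _ _ tendsto_const U])
    show "\<forall>\<^sub>F n in sequentially. 1 / P \<le> real (lattice_count \<delta> d n) / real n ^ d"
      using lattice_count_bounds(1)[OF assms] P
      by (auto intro!: eventually_mono[OF eventually_gt_at_top[of 0]] simp: field_simps P_def)
    show "\<forall>\<^sub>F n in sequentially. real (lattice_count \<delta> d n) / real n ^ d \<le> (real (n + s) / real n) ^ d / P"
      using lattice_count_bounds(2)[OF assms] P
      by (auto intro!: eventually_mono[OF eventually_gt_at_top[of 0]] simp: field_simps P_def s_def power_divide)
  qed
qed

text \<open>A generator of degree \<open>a\<close> only shifts the count, which does not affect the leading term.\<close>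

lemma lattice_count_shift_limit:
  assumes "\<And>i. i \<in> {1..d} \<Longrightarrow> \<delta> i > 0"
  shows "(\<lambda>n. real (if a \<le> n then lattice_count \<delta> d (n - a) else 0) / real n ^ d)
    \<longlonglongrightarrow> 1 / (fact d * real (\<Prod>i\<in>{1..d}. \<delta> i))"
proof (rule LIMSEQ_offset[where k = a])
  let ?L = "1 / (fact d * real (\<Prod>i\<in>{1..d}. \<delta> i))"
  have "(\<lambda>n. (real (lattice_count \<delta> d n) / real n ^ d) / (real (n + a) / real n) ^ d) \<longlonglongrightarrow> ?L / 1"
    by (intro tendsto_divide lattice_count_limit power_shift_limit assms) auto
  then have "(\<lambda>n. (real (lattice_count \<delta> d n) / real n ^ d) / (real (n + a) / real n) ^ d) \<longlonglongrightarrow> ?L" by simp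
  then show "(\<lambda>n. real (if a \<le> n + a then lattice_count \<delta> d (n + a - a) else 0) / real (n + a) ^ d) \<longlonglongrightarrow> ?L"
    by (rule Lim_transform_eventually)
       (rule eventually_mono[OF eventually_gt_at_top[of 0]], simp add: power_divide)
qed

section \<open>Staircases and their Hilbert functions\<close>

text \<open>The combinatorial model of a finitely generated graded module over a polynomial ring: \<open>B\<close> stands for the
  standard monomials, \<open>(l, b)\<close> for the multiple of the \<open>l\<close>-th generator (of degree \<open>e l\<close>) by the monomial
  with exponent \<open>b\<close>. A generator \<open>l\<close> whose column is all of \<open>exponents d\<close> behaves like a free summand up to
  lower order terms, so \<open>generic_rank\<close> is the rank of the module.\<close>

locale staircase =
  fixes d m :: nat and \<delta> e :: "nat \<Rightarrow> nat" and B :: "(nat \<times> (nat \<Rightarrow> nat)) set"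
  assumes degree_pos: "\<And>i. i \<in> {1..d} \<Longrightarrow> \<delta> i > 0"
    and in_exponents: "\<And>l b. (l, b) \<in> B \<Longrightarrow> l < m \<and> b \<in> exponents d"
    and downward: "\<And>l b c. \<lbrakk>(l, \<lambda>i. b i + c i) \<in> B; b \<in> exponents d; c \<in> exponents d\<rbrakk> \<Longrightarrow> (l, b) \<in> B"
begin

abbreviation deg :: "nat \<times> (nat \<Rightarrow> nat) \<Rightarrow> nat" where
  "deg x \<equiv> weight \<delta> d (snd x) + e (fst x)"

definition hilbert :: "nat \<Rightarrow> nat" where
  "hilbert j = card {x \<in> B. deg x = j}"

definition truncated_hilbert :: "nat \<Rightarrow> nat \<Rightarrow> nat" where
  "truncated_hilbert q j = card {x \<in> B. deg x = j \<and> snd x \<in> exponent_box d (\<lambda>_. q)}"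

definition full_columns :: "nat set" where
  "full_columns = {l. l < m \<and> {l} \<times> exponents d \<subseteq> B}"

definition generic_rank :: nat where
  "generic_rank = card full_columns"

lemma finite_full: "finite full_columns"
  by (simp add: full_columns_def)

lemma finite_deg_le: "finite {x \<in> B. deg x \<le> n}"
proof (rule finite_subset)
  show "{x \<in> B. deg x \<le> n} \<subseteq> {..<m} \<times> {b \<in> exponents d. weight \<delta> d b \<le> n}"
    using in_exponents by auto
qed (use finite_weight_le[OF degree_pos] in auto)

lemma finite_deg_eq: "finite {x \<in> B. deg x = n}"
  by (rule finite_subset[OF _ finite_deg_le[of n]]) auto

lemma gap_exists:
  assumes "l < m" "l \<notin> full_columns"
  obtains a where "a \<in> exponents d" "(l, a) \<notin> B"
  using assms by (auto simp: full_columns_def)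

text \<open>If \<open>a\<close> is missing from a down-closed set, then so is everything above \<open>a\<close>; hence each member has a
  coordinate below the corresponding one of \<open>a\<close>, which leaves \<open>d\<close> thin slabs of the cube.\<close>

lemma gap_bound:
  assumes "a \<in> exponents d" "(l, a) \<notin> B"
  shows "card {b \<in> exponent_box d (\<lambda>_. q). (l, b) \<in> B} \<le> (\<Sum>i\<in>{1..d}. a i * q ^ (d - 1))"
proof -
  have "{b \<in> exponent_box d (\<lambda>_. q). (l, b) \<in> B} \<subseteq> (\<Union>i\<in>{1..d}. exponent_box d ((\<lambda>_. q)(i := a i)))"
  proof
    fix b assume b: "b \<in> {b \<in> exponent_box d (\<lambda>_. q). (l, b) \<in> B}"
    then have bX: "b \<in> exponents d" by (auto simp: exponent_box_def)
    have "\<exists>i\<in>{1..d}. b i < a i"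
    proof (rule ccontr)
      assume "\<not> (\<exists>i\<in>{1..d}. b i < a i)"
      then have "a i \<le> b i" for i
        using assms(1) by (cases "i \<in> {1..d}") (auto simp: exponents_def not_less)
      then have "b = (\<lambda>i. a i + (b i - a i))" by simp
      moreover have "(\<lambda>i. b i - a i) \<in> exponents d" using bX by (auto simp: exponents_def)
      moreover have "(l, b) \<in> B" using b by simp
      ultimately have "(l, a) \<in> B" using downward[of l a "\<lambda>i. b i - a i"] assms(1) by metis
      then show False using assms by simp
    qed
    then show "b \<in> (\<Union>i\<in>{1..d}. exponent_box d ((\<lambda>_. q)(i := a i)))" using b by (auto simp: exponent_box_def)
  qed
  then have "card {b \<in> exponent_box d (\<lambda>_. q). (l, b) \<in> B} \<le> card (\<Union>i\<in>{1..d}. exponent_box d ((\<lambda>_. q)(i := a i)))"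
    by (intro card_mono) (auto simp: finite_exponent_box)
  also have "\<dots> \<le> (\<Sum>i\<in>{1..d}. card (exponent_box d ((\<lambda>_. q)(i := a i))))"
    by (intro card_UN_le) auto
  also have "\<dots> = (\<Sum>i\<in>{1..d}. a i * q ^ (d - 1))"
  proof (rule sum.cong[OF refl])
    fix i assume i: "i \<in> {1..d}"
    have "card (exponent_box d ((\<lambda>_. q)(i := a i))) = (\<Prod>k\<in>{1..d}. ((\<lambda>_. q)(i := a i)) k)"
      by (rule card_exponent_box)
    also have "\<dots> = a i * (\<Prod>k\<in>{1..d} - {i}. q)"
      using i by (subst prod.remove[of _ i]) (auto intro!: prod.cong)
    finally show "card (exponent_box d ((\<lambda>_. q)(i := a i))) = a i * q ^ (d - 1)" using i by simp
  qed
  finally show ?thesis .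
qed

text \<open>The bound is written as \<open>C q^d / q\<close> so that it is also correct for \<open>d = 0\<close>, where it holds with \<open>C = 0\<close>.\<close>

lemma gap_const_exists:
  "\<exists>C::real. \<forall>q>0. real (card {x \<in> B. fst x \<notin> full_columns \<and> snd x \<in> exponent_box d (\<lambda>_. q)}) \<le> C * real q ^ d / real q"
proof -
  have "\<forall>l\<in>{..<m} - full_columns. \<exists>a. a \<in> exponents d \<and> (l, a) \<notin> B"
    by (metis DiffE gap_exists lessThan_iff)
  then obtain a where a: "\<And>l. l \<in> {..<m} - full_columns \<Longrightarrow> a l \<in> exponents d \<and> (l, a l) \<notin> B"
    by metis
  define C where "C = (\<Sum>l\<in>{..<m} - full_columns. \<Sum>i\<in>{1..d}. a l i)"
  have "real (card {x \<in> B. fst x \<notin> full_columns \<and> snd x \<in> exponent_box d (\<lambda>_. q)}) \<le> real C * real q ^ d / real q"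
    if "q > 0" for q
  proof -
    have "{x \<in> B. fst x \<notin> full_columns \<and> snd x \<in> exponent_box d (\<lambda>_. q)} =
        (SIGMA l:{..<m} - full_columns. {b \<in> exponent_box d (\<lambda>_. q). (l, b) \<in> B})"
      using in_exponents by auto
    then have "card {x \<in> B. fst x \<notin> full_columns \<and> snd x \<in> exponent_box d (\<lambda>_. q)} =
        (\<Sum>l\<in>{..<m} - full_columns. card {b \<in> exponent_box d (\<lambda>_. q). (l, b) \<in> B})"
      by (simp add: card_SigmaI finite_exponent_box)
    also have "\<dots> \<le> (\<Sum>l\<in>{..<m} - full_columns. \<Sum>i\<in>{1..d}. a l i * q ^ (d - 1))"
      using a by (intro sum_mono gap_bound) auto
    finally have "card {x \<in> B. fst x \<notin> full_columns \<and> snd x \<in> exponent_box d (\<lambda>_. q)} \<le> C * q ^ (d - 1)"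
      by (simp add: C_def sum_distrib_right)
    then have "real (card {x \<in> B. fst x \<notin> full_columns \<and> snd x \<in> exponent_box d (\<lambda>_. q)}) \<le> real (C * q ^ (d - 1))"
      by (simp only: of_nat_le_iff)
    also have "\<dots> = real C * real q ^ d / real q"
      using that by (cases d) (auto simp: C_def)
    finally show ?thesis .
  qed
  then show ?thesis by blast
qed

lemma sum_hilbert: "(\<Sum>j\<le>n. hilbert j) = card {x \<in> B. deg x \<le> n}"
proof -
  have "{x \<in> B. deg x \<le> n} = (\<Union>j\<le>n. {x \<in> B. deg x = j})" by auto
  then show ?thesis
    unfolding hilbert_def by (simp only:) (subst card_UN_disjoint; use finite_deg_eq in auto)
qed

text \<open>Each full column contributes a shifted lattice point count, and all the other columns together are
  negligible.\<close>

lemma sum_hilbert_limit: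
  "(\<lambda>n. real (\<Sum>j\<le>n. hilbert j) / real n ^ d) \<longlonglongrightarrow> real generic_rank / (fact d * real (\<Prod>i\<in>{1..d}. \<delta> i))"
proof -
  let ?v = "1 / (fact d * real (\<Prod>i\<in>{1..d}. \<delta> i))"
  define G where "G n = card {x \<in> B. fst x \<notin> full_columns \<and> deg x \<le> n}" for n
  obtain C where C: "\<And>q. q > 0 \<Longrightarrow> real (card {x \<in> B. fst x \<notin> full_columns \<and> snd x \<in> exponent_box d (\<lambda>_. q)}) \<le> C * real q ^ d / real q"
    using gap_const_exists by blast
  have split: "(\<Sum>j\<le>n. hilbert j) = (\<Sum>l\<in>full_columns. if e l \<le> n then lattice_count \<delta> d (n - e l) else 0) + G n" for n
  proof -
    have "card {x \<in> B. deg x \<le> n} = card {x \<in> B. fst x \<in> full_columns \<and> deg x \<le> n} + card {x \<in> B. fst x \<notin> full_columns \<and> deg x \<le> n}"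
      by (subst card_Un_disjoint[symmetric]) (auto intro: finite_subset[OF _ finite_deg_le[of n]] intro!: arg_cong[of _ _ card])
    also have "{x \<in> B. fst x \<in> full_columns \<and> deg x \<le> n} = (SIGMA l:full_columns. {b \<in> exponents d. weight \<delta> d b + e l \<le> n})"
      using in_exponents by (fastforce simp: full_columns_def)
    also have "card \<dots> = (\<Sum>l\<in>full_columns. card {b \<in> exponents d. weight \<delta> d b + e l \<le> n})"
      by (intro card_SigmaI finite_full ballI finite_subset[OF _ finite_weight_le[of d \<delta> n]] degree_pos) auto
    also have "\<dots> = (\<Sum>l\<in>full_columns. if e l \<le> n then lattice_count \<delta> d (n - e l) else 0)"
    proof (rule sum.cong[OF refl])
      fix l
      show "card {b \<in> exponents d. weight \<delta> d b + e l \<le> n} = (if e l \<le> n then lattice_count \<delta> d (n - e l) else 0)"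
      proof (cases "e l \<le> n")
        case True
        then have "{b \<in> exponents d. weight \<delta> d b + e l \<le> n} = {b \<in> exponents d. weight \<delta> d b \<le> n - e l}" by auto
        then show ?thesis using True by (simp add: lattice_count_def)
      qed auto
    qed
    finally show ?thesis by (simp add: sum_hilbert G_def)
  qed
  have main: "(\<lambda>n. \<Sum>l\<in>full_columns. real (if e l \<le> n then lattice_count \<delta> d (n - e l) else 0) / real n ^ d) \<longlonglongrightarrow> (\<Sum>l\<in>full_columns. ?v)"
    by (intro tendsto_sum lattice_count_shift_limit degree_pos)
  have "(\<lambda>n. real (G n) / real n ^ d) \<longlonglongrightarrow> 0"
  proof (rule tendsto_sandwich[OF _ _ tendsto_const])
    have "(\<lambda>n. C * (real (n + 1) / real n) ^ d * (1 / real (n + 1))) \<longlonglongrightarrow> C * 1 * 0"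
      by (intro tendsto_intros power_shift_limit LIMSEQ_ignore_initial_segment[where k = 1] lim_1_over_n)
    then show "(\<lambda>n. C * (real (n + 1) / real n) ^ d * (1 / real (n + 1))) \<longlonglongrightarrow> 0" by simp
    show "\<forall>\<^sub>F n in sequentially. real (G n) / real n ^ d \<le> C * (real (n + 1) / real n) ^ d * (1 / real (n + 1))"
    proof (rule eventually_mono[OF eventually_gt_at_top[of 0]])
      fix n :: nat assume n: "0 < n"
      have "G n \<le> card {x \<in> B. fst x \<notin> full_columns \<and> snd x \<in> exponent_box d (\<lambda>_. Suc n)}"
        unfolding G_def
      proof (rule card_mono)
        show "finite {x \<in> B. fst x \<notin> full_columns \<and> snd x \<in> exponent_box d (\<lambda>_. Suc n)}"
          by (rule finite_subset[of _ "{..<m} \<times> exponent_box d (\<lambda>_. Suc n)"]) (use in_exponents in \<open>auto simp: finite_exponent_box\<close>)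
        show "{x \<in> B. fst x \<notin> full_columns \<and> deg x \<le> n} \<subseteq> {x \<in> B. fst x \<notin> full_columns \<and> snd x \<in> exponent_box d (\<lambda>_. Suc n)}"
          using weight_le_subset_box[of d \<delta> n] degree_pos in_exponents by fastforce
      qed
      then have "real (G n) \<le> C * real (Suc n) ^ d / real (Suc n)"
        using C[of "Suc n"] by linarith
      then have "real (G n) / real n ^ d \<le> C * real (Suc n) ^ d / real (Suc n) / real n ^ d"
        by (intro divide_right_mono) auto
      also have "\<dots> = C * (real (n + 1) / real n) ^ d * (1 / real (n + 1))"
        by (simp add: power_divide)
      finally show "real (G n) / real n ^ d \<le> C * (real (n + 1) / real n) ^ d * (1 / real (n + 1))" .
    qed
  qed simp
  then have "(\<lambda>n. (\<Sum>l\<in>full_columns. real (if e l \<le> n then lattice_count \<delta> d (n - e l) else 0) / real n ^ d) + real (G n) / real n ^ d)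
      \<longlonglongrightarrow> (\<Sum>l\<in>full_columns. ?v) + 0"
    by (rule tendsto_add[OF main])
  then show ?thesis
    by (simp add: split generic_rank_def sum_divide_distrib add_divide_distrib)
qed

end

section \<open>Exponential sums over a staircase\<close>

text \<open>The limit is the integral of \<open>exp (z t)\<close> over \<open>[0, 1]\<close>; the geometric series makes it explicit.\<close>

lemma exp_Riemann_sum_limit:
  fixes z :: complex
  shows "(\<lambda>q. (\<Sum>k<q. exp (z * of_nat k / of_nat q)) / of_nat q) \<longlonglongrightarrow> (if z = 0 then 1 else (exp z - 1) / z)"
proof (cases "z = 0")
  case True
  have "\<forall>\<^sub>F q in sequentially. 1 = (\<Sum>k<q. exp (z * of_nat k / of_nat q)) / of_nat q"
    using True by (intro eventually_mono[OF eventually_gt_at_top[of 0]]) simp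
  from Lim_transform_eventually[OF tendsto_const this] show ?thesis using True by simp
next
  case False
  have d: "((\<lambda>h::complex. (exp h - 1) / h) \<longlongrightarrow> 1) (at 0)"
    using DERIV_exp[of "0::complex"] by (simp add: DERIV_def)
  have h: "(\<lambda>q. z / of_nat q) \<longlonglongrightarrow> 0"
    by (rule lim_const_over_n)
  have "filterlim (\<lambda>q. z / of_nat q) (at 0) sequentially"
    unfolding filterlim_at
    using h False by (auto intro!: eventually_mono[OF eventually_gt_at_top[of 0]])
  from filterlim_compose[OF d this]
  have "(\<lambda>q. z * ((exp (z / of_nat q) - 1) / (z / of_nat q))) \<longlonglongrightarrow> z * 1"
    by (intro tendsto_mult tendsto_const)
  then have lim: "(\<lambda>q. of_nat q * (exp (z / of_nat q) - 1)) \<longlonglongrightarrow> z"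
    using False by (simp add: mult.commute)
  then have "(\<lambda>q. (exp z - 1) / (of_nat q * (exp (z / of_nat q) - 1))) \<longlonglongrightarrow> (exp z - 1) / z"
    using False by (intro tendsto_intros) auto
  moreover have "\<forall>\<^sub>F q in sequentially. of_nat q * (exp (z / of_nat q) - 1) \<noteq> 0"
    using lim False by (intro tendsto_imp_eventually_ne)
  then have "\<forall>\<^sub>F q in sequentially. (exp z - 1) / (of_nat q * (exp (z / of_nat q) - 1)) =
      (\<Sum>k<q. exp (z * of_nat k / of_nat q)) / of_nat q"
  proof eventually_elim
    case (elim q)
    then have q: "of_nat q \<noteq> (0 :: complex)" "exp (z / of_nat q) \<noteq> 1" by auto
    have "(\<Sum>k<q. exp (z * of_nat k / of_nat q)) = (\<Sum>k<q. exp (z / of_nat q) ^ k)"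
      by (intro sum.cong refl) (simp flip: exp_of_nat_mult add: mult.commute)
    also have "\<dots> = (exp (z / of_nat q) ^ q - 1) / (exp (z / of_nat q) - 1)"
      using q by (simp add: geometric_sum)
    also have "exp (z / of_nat q) ^ q = exp z"
      using q by (simp flip: exp_of_nat_mult)
    finally show ?case by (simp add: mult.commute)
  qed
  ultimately show ?thesis using False by (auto intro: Lim_transform_eventually)
qed

context staircase
begin

text \<open>An upper bound for the degrees of staircase elements in the cube \<open>[0, q)^d\<close>. It grows linearly in \<open>q\<close>,
  which keeps \<open>exp (- \<i> y j / q)\<close> bounded on the degrees that occur.\<close>

definition top_degree :: "nat \<Rightarrow> nat" where
  "top_degree q = q * (\<Sum>i\<in>{1..d}. \<delta> i) + (\<Sum>l<m. e l)"

lemma deg_le_top: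
  assumes "x \<in> B" "snd x \<in> exponent_box d (\<lambda>_. q)"
  shows "deg x \<le> top_degree q"
proof -
  have "weight \<delta> d (snd x) \<le> (\<Sum>i\<in>{1..d}. \<delta> i * q)"
    unfolding weight_def using assms(2) by (intro sum_mono mult_left_mono) (auto simp: exponent_box_def intro: less_imp_le)
  moreover have "e (fst x) \<le> (\<Sum>l<m. e l)"
    using in_exponents[of "fst x" "snd x"] assms(1) by (intro member_le_sum) auto
  ultimately show ?thesis by (simp add: top_degree_def sum_distrib_left mult.commute)
qed

lemma truncated_hilbert_eq_0: "truncated_hilbert q j = 0" if "top_degree q < j"
proof -
  have "{x \<in> B. deg x = j \<and> snd x \<in> exponent_box d (\<lambda>_. q)} = {}"
    using deg_le_top[of _ q] that by fastforce
  then show ?thesis by (simp only: truncated_hilbert_def card.empty)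
qed

lemma finite_trunc: "finite {x \<in> B. snd x \<in> exponent_box d (\<lambda>_. q)}"
  by (rule finite_subset[OF _ finite_deg_le[of "top_degree q"]]) (auto intro: deg_le_top)

lemma sum_truncated_hilbert:
  fixes w :: "nat \<Rightarrow> 'c :: comm_semiring_1"
  shows "(\<Sum>j\<le>top_degree q. of_nat (truncated_hilbert q j) * w j) = (\<Sum>x | x \<in> B \<and> snd x \<in> exponent_box d (\<lambda>_. q). w (deg x))"
proof -
  let ?S = "{x \<in> B. snd x \<in> exponent_box d (\<lambda>_. q)}"
  have "(\<Sum>x\<in>?S. w (deg x)) = (\<Sum>j\<le>top_degree q. \<Sum>x | x \<in> ?S \<and> deg x = j. w (deg x))"
    by (rule sum.group[symmetric]) (use deg_le_top in \<open>auto simp: finite_trunc\<close>)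
  also have "\<dots> = (\<Sum>j\<le>top_degree q. of_nat (truncated_hilbert q j) * w j)"
    by (rule sum.cong[OF refl])
       (simp add: truncated_hilbert_def conj_comms cong: conj_cong)
  finally show ?thesis by simp
qed

lemma card_full_trunc:
  "card {x \<in> B. fst x \<in> full_columns \<and> snd x \<in> exponent_box d (\<lambda>_. q)} = generic_rank * q ^ d"
proof -
  have "{x \<in> B. fst x \<in> full_columns \<and> snd x \<in> exponent_box d (\<lambda>_. q)} = full_columns \<times> exponent_box d (\<lambda>_. q)"
    by (auto simp: full_columns_def exponent_box_def)
  then show ?thesis by (simp add: card_cartesian_product card_exponent_box generic_rank_def)
qed

text \<open>The hypothesis \<open>tile\<close> is what results when translates of a set with \<open>g i\<close> elements in degree \<open>i\<close>
  by the sublattice of step \<open>q\<close> cover the staircase. Up to degree \<open>q k\<close> there are about \<open>k^d / (d! \<Prod> \<delta>_i)\<close>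
  translates, whereas the staircase has about \<open>r (q k)^d / (d! \<Prod> \<delta>_i)\<close> elements; dividing by \<open>k^d\<close> and letting
  \<open>k\<close> tend to infinity shows that each translate has at least \<open>r q^d\<close> elements.\<close>

lemma tiling_lower_bound:
  fixes g :: "nat \<Rightarrow> nat"
  assumes q: "q > 0" and vanish: "\<And>j. j > T \<Longrightarrow> g j = 0"
    and tile: "\<And>j. hilbert j \<le> (\<Sum>c | c \<in> exponents d \<and> q * weight \<delta> d c \<le> j. g (j - q * weight \<delta> d c))"
  shows "generic_rank * q ^ d \<le> (\<Sum>j\<le>T. g j)"
proof -
  let ?G = "\<Sum>j\<le>T. g j"
  let ?P = "fact d * real (\<Prod>i\<in>{1..d}. \<delta> i)"
  have P: "?P > 0" using degree_pos by (auto intro!: mult_pos_pos prod_pos)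
  have part: "(\<Sum>i\<le>k. g i) \<le> ?G" for k
  proof -
    have "(\<Sum>i\<le>k. g i) = (\<Sum>i\<in>{..k} \<inter> {..T}. g i)"
      by (rule sum.mono_neutral_right) (use vanish in \<open>auto simp: linorder_not_le[symmetric]\<close>)
    also have "\<dots> \<le> ?G" by (rule sum_mono2) auto
    finally show ?thesis .
  qed
  have bound: "(\<Sum>j\<le>q * k. hilbert j) \<le> lattice_count \<delta> d k * ?G" for k
  proof -
    let ?C = "{c \<in> exponents d. weight \<delta> d c \<le> k}"
    have fin: "finite ?C" by (rule finite_weight_le[OF degree_pos])
    have "(\<Sum>j\<le>q * k. hilbert j) \<le> (\<Sum>j\<le>q * k. \<Sum>c | c \<in> exponents d \<and> q * weight \<delta> d c \<le> j. g (j - q * weight \<delta> d c))"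
      by (intro sum_mono tile)
    also have "\<dots> = (\<Sum>j\<le>q * k. \<Sum>c | c \<in> ?C \<and> q * weight \<delta> d c \<le> j. g (j - q * weight \<delta> d c))"
    proof (intro sum.cong refl)
      fix j assume j: "j \<in> {..q * k}"
      have "weight \<delta> d c \<le> k" if "q * weight \<delta> d c \<le> j" for c
      proof -
        have "q * weight \<delta> d c \<le> q * k" using that j by (meson atMost_iff order_trans)
        then show ?thesis using q by simp
      qed
      then show "{c \<in> exponents d. q * weight \<delta> d c \<le> j} = {c \<in> ?C. q * weight \<delta> d c \<le> j}" by auto
    qed
    also have "\<dots> = (\<Sum>c\<in>?C. \<Sum>j | j \<in> {..q * k} \<and> q * weight \<delta> d c \<le> j. g (j - q * weight \<delta> d c))"
      by (rule sum.swap_restrict) (use fin in auto)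
    also have "\<dots> \<le> (\<Sum>c\<in>?C. ?G)"
    proof (rule sum_mono)
      fix c assume "c \<in> ?C"
      then have "(\<Sum>j | j \<in> {..q * k} \<and> q * weight \<delta> d c \<le> j. g (j - q * weight \<delta> d c)) = (\<Sum>i\<le>q * k - q * weight \<delta> d c. g i)"
        by (intro sum.reindex_bij_witness[of _ "\<lambda>i. i + q * weight \<delta> d c" "\<lambda>j. j - q * weight \<delta> d c"])
           (auto simp: le_diff_conv2)
      also have "\<dots> \<le> ?G" by (rule part)
      finally show "(\<Sum>j | j \<in> {..q * k} \<and> q * weight \<delta> d c \<le> j. g (j - q * weight \<delta> d c)) \<le> ?G" .
    qed
    finally show ?thesis by (simp add: lattice_count_def)
  qed
  have sub: "filterlim (\<lambda>k. q * k) sequentially sequentially"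
    using q by (intro filterlim_subseq strict_monoI) simp
  have "(\<lambda>k. real q ^ d * (real (\<Sum>j\<le>q * k. hilbert j) / real (q * k) ^ d)) \<longlonglongrightarrow> real q ^ d * (real generic_rank / ?P)"
    by (intro tendsto_mult tendsto_const filterlim_compose[OF sum_hilbert_limit sub])
  moreover have "(\<lambda>k. real (lattice_count \<delta> d k) / real k ^ d * real ?G) \<longlonglongrightarrow> 1 / ?P * real ?G"
    by (intro tendsto_mult tendsto_const lattice_count_limit degree_pos)
  moreover have "real q ^ d * (real (\<Sum>j\<le>q * k. hilbert j) / real (q * k) ^ d) \<le> real (lattice_count \<delta> d k) / real k ^ d * real ?G" for k
  proof -
    have "real q ^ d * (real (\<Sum>j\<le>q * k. hilbert j) / real (q * k) ^ d) = real (\<Sum>j\<le>q * k. hilbert j) / real k ^ d"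
      using q by (simp add: power_mult_distrib)
    also have "\<dots> \<le> real (lattice_count \<delta> d k * ?G) / real k ^ d"
      using bound[of k] by (intro divide_right_mono) (simp_all only: of_nat_le_iff, simp)
    finally show ?thesis by simp
  qed
  ultimately have "real q ^ d * (real generic_rank / ?P) \<le> 1 / ?P * real ?G"
    by (intro LIMSEQ_le) auto
  then have "real (generic_rank * q ^ d) \<le> real ?G"
    using P by (simp add: divide_le_cancel mult.commute)
  then show ?thesis by (simp only: of_nat_le_iff)
qed

text \<open>The hypotheses bound \<open>g q\<close> from above in each degree and, by \<open>tiling_lower_bound\<close>, from below in total, and the bounds differ
  by the size of the incomplete columns in the cube. So \<open>g q\<close> may be replaced by the contribution of the full
  columns, at a cost of order \<open>q^(d-1)\<close>; on full columns the sum over the cube factors into Riemann sums.\<close>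

theorem scaled_exponential_sum_limit:
  fixes g :: "nat \<Rightarrow> nat \<Rightarrow> nat" and y :: complex
  assumes le: "\<And>q j. q > 0 \<Longrightarrow> g q j \<le> truncated_hilbert q j"
    and tile: "\<And>q j. q > 0 \<Longrightarrow> hilbert j \<le> (\<Sum>c | c \<in> exponents d \<and> q * weight \<delta> d c \<le> j. g q (j - q * weight \<delta> d c))"
  shows "(\<lambda>q. (1 / of_nat q) ^ d * suminf (\<lambda>j. of_nat (g q j) * exp (- \<i> * y * of_nat j / of_nat q)))
    \<longlonglongrightarrow> of_nat generic_rank * (\<Prod>i\<in>{1..d}. if y = 0 then 1 else (1 - exp (- \<i> * of_nat (\<delta> i) * y)) / (\<i> * of_nat (\<delta> i) * y))"
proof -
  let ?E = "\<lambda>q j. exp (- \<i> * y * of_nat j / of_nat q)"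
  let ?S = "\<lambda>q. suminf (\<lambda>j. of_nat (g q j) * ?E q j)"
  let ?gap = "\<lambda>q. {x \<in> B. fst x \<notin> full_columns \<and> snd x \<in> exponent_box d (\<lambda>_. q)}"
  define M where "M = exp (norm y * real ((\<Sum>i\<in>{1..d}. \<delta> i) + (\<Sum>l<m. e l)))"
  define main where "main q = (\<Sum>x | x \<in> B \<and> fst x \<in> full_columns \<and> snd x \<in> exponent_box d (\<lambda>_. q). ?E q (deg x))" for q
  obtain C where C: "\<And>q. q > 0 \<Longrightarrow> real (card (?gap q)) \<le> C * real q ^ d / real q"
    using gap_const_exists by blast
  \<comment> \<open>The exponentials are bounded uniformly in \<open>q\<close> on all degrees that occur.\<close>
  have M: "norm (?E q j) \<le> M" if "q > 0" "j \<le> top_degree q" for q j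
  proof -
    have "real j \<le> real (q * ((\<Sum>i\<in>{1..d}. \<delta> i) + (\<Sum>l<m. e l)))"
      using that(2,1) unfolding top_degree_def of_nat_le_iff
      by (elim order_trans) (simp add: add_mult_distrib2)
    then have "norm y * (real j / real q) \<le> norm y * real ((\<Sum>i\<in>{1..d}. \<delta> i) + (\<Sum>l<m. e l))"
      using that(1) by (intro mult_left_mono) (simp_all add: field_simps)
    moreover have "norm (- \<i> * y * of_nat j / of_nat q) = norm y * (real j / real q)"
      by (simp add: norm_mult norm_divide)
    ultimately show ?thesis unfolding M_def
      by (smt (verit) norm_exp exp_le_cancel_iff)
  qed
  have M0: "M \<ge> 0" by (simp add: M_def)
  have S: "?S q = (\<Sum>j\<le>top_degree q. of_nat (g q j) * ?E q j)" if "q > 0" for q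
    by (rule suminf_finite) (use le[OF that] truncated_hilbert_eq_0[of q] in \<open>auto simp: not_le\<close>, metis le_zero_eq)
  have err: "norm (?S q - main q) \<le> 2 * M * C * real q ^ d / real q" if q: "q > 0" for q
  proof -
    have g0: "g q j = 0" if "j > top_degree q" for j
      using le[OF q, of j] truncated_hilbert_eq_0[OF that] by simp
    have total: "(\<Sum>j\<le>top_degree q. truncated_hilbert q j) = generic_rank * q ^ d + card (?gap q)"
    proof -
      have "(\<Sum>j\<le>top_degree q. truncated_hilbert q j) = card {x \<in> B. snd x \<in> exponent_box d (\<lambda>_. q)}"
        using sum_truncated_hilbert[of q "\<lambda>_. 1::nat"] by simp
      also have "\<dots> = card {x \<in> B. fst x \<in> full_columns \<and> snd x \<in> exponent_box d (\<lambda>_. q)} + card (?gap q)"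
        by (subst card_Un_disjoint[symmetric])
           (auto intro: finite_subset[OF _ finite_trunc[of q]] intro!: arg_cong[of _ _ card])
      finally show ?thesis by (simp add: card_full_trunc)
    qed
    have low: "generic_rank * q ^ d \<le> (\<Sum>j\<le>top_degree q. g q j)"
      by (rule tiling_lower_bound[OF q g0 tile[OF q]])
    have "(\<Sum>x | x \<in> B \<and> snd x \<in> exponent_box d (\<lambda>_. q). ?E q (deg x)) = main q + (\<Sum>x\<in>?gap q. ?E q (deg x))"
      unfolding main_def
      by (subst sum.union_disjoint[symmetric])
         (auto intro: finite_subset[OF _ finite_trunc[of q]] intro!: sum.cong)
    moreover have "(\<Sum>j\<le>top_degree q. of_nat (truncated_hilbert q j - g q j) * ?E q j) =
        (\<Sum>j\<le>top_degree q. of_nat (truncated_hilbert q j) * ?E q j) - ?S q"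
      by (simp only: S[OF q] of_nat_diff[OF le[OF q]] left_diff_distrib sum_subtractf)
    ultimately have split: "?S q - main q = (\<Sum>x\<in>?gap q. ?E q (deg x)) - (\<Sum>j\<le>top_degree q. of_nat (truncated_hilbert q j - g q j) * ?E q j)"
      by (simp only: sum_truncated_hilbert) (simp only: algebra_simps)
    have "norm (\<Sum>x\<in>?gap q. ?E q (deg x)) \<le> (\<Sum>x\<in>?gap q. M)"
      by (rule sum_norm_le, rule M[OF q]) (use deg_le_top in auto)
    moreover have "norm (\<Sum>j\<le>top_degree q. of_nat (truncated_hilbert q j - g q j) * ?E q j) \<le>
        (\<Sum>j\<le>top_degree q. real (truncated_hilbert q j - g q j) * M)"
      by (rule sum_norm_le) (use M q in \<open>auto simp: norm_mult intro!: mult_left_mono\<close>)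
    \<comment> \<open>The total of the nonnegative differences is at most the gap, by the tiling bound.\<close>
    moreover have "(\<Sum>j\<le>top_degree q. real (truncated_hilbert q j - g q j) * M) \<le> real (card (?gap q)) * M"
    proof -
      have "(\<Sum>j\<le>top_degree q. truncated_hilbert q j - g q j) = (\<Sum>j\<le>top_degree q. truncated_hilbert q j) - (\<Sum>j\<le>top_degree q. g q j)"
        by (rule sum_subtractf_nat) (use le[OF q] in auto)
      then have "(\<Sum>j\<le>top_degree q. truncated_hilbert q j - g q j) \<le> card (?gap q)"
        using low total by simp
      then have "real (\<Sum>j\<le>top_degree q. truncated_hilbert q j - g q j) * M \<le> real (card (?gap q)) * M"
        using M0 by (intro mult_right_mono) (simp_all only: of_nat_le_iff)
      then show ?thesis by (simp add: sum_distrib_right)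
    qed
    ultimately have "norm (?S q - main q) \<le> 2 * M * real (card (?gap q))"
      unfolding split using norm_triangle_ineq4[of "\<Sum>x\<in>?gap q. ?E q (deg x)" "\<Sum>j\<le>top_degree q. of_nat (truncated_hilbert q j - g q j) * ?E q j"]
      by (simp add: algebra_simps)
    also have "\<dots> \<le> 2 * M * (C * real q ^ d / real q)"
      using C[OF q] M0 by (intro mult_left_mono) auto
    finally show ?thesis by simp
  qed
  have diff: "(\<lambda>q. (1 / of_nat q) ^ d * (?S q - main q)) \<longlonglongrightarrow> 0"
  proof (rule tendsto_0_le[where K = 1])
    have "(\<lambda>q. 2 * M * C * (1 / real q)) \<longlonglongrightarrow> 2 * M * C * 0"
      by (intro tendsto_intros lim_1_over_n)
    then show "(\<lambda>q. 2 * M * C * (1 / real q)) \<longlonglongrightarrow> 0" by simp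
    show "\<forall>\<^sub>F q in sequentially. norm ((1 / of_nat q) ^ d * (?S q - main q)) \<le> norm (2 * M * C * (1 / real q)) * 1"
    proof (rule eventually_mono[OF eventually_gt_at_top[of 0]])
      fix q :: nat assume q: "0 < q"
      have "norm ((1 / of_nat q) ^ d * (?S q - main q)) = (1 / real q) ^ d * norm (?S q - main q)"
        by (simp add: norm_mult norm_power norm_divide)
      also have "\<dots> \<le> (1 / real q) ^ d * (2 * M * C * real q ^ d / real q)"
        by (intro mult_left_mono err q) auto
      also have "\<dots> = 2 * M * C * (1 / real q)" using q by (simp add: power_divide)
      finally show "norm ((1 / of_nat q) ^ d * (?S q - main q)) \<le> norm (2 * M * C * (1 / real q)) * 1"
        using abs_ge_self order_trans by fastforce
    qed
  qed
  define \<phi> where "\<phi> i = (if y = 0 then 1 else (1 - exp (- \<i> * of_nat (\<delta> i) * y)) / (\<i> * of_nat (\<delta> i) * y))" for i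
  have \<phi>: "(\<lambda>q. (\<Sum>k<q. exp ((- \<i> * y * of_nat (\<delta> i)) * of_nat k / of_nat q)) / of_nat q) \<longlonglongrightarrow> \<phi> i" if i: "i \<in> {1..d}" for i
  proof -
    let ?z = "- \<i> * y * of_nat (\<delta> i)"
    have "\<phi> i = (if ?z = 0 then 1 else (exp ?z - 1) / ?z)"
      using degree_pos[OF i] by (auto simp: \<phi>_def field_simps)
    then show ?thesis using exp_Riemann_sum_limit[of ?z] by (simp only:)
  qed
  have main: "(1 / of_nat q) ^ d * main q = (\<Sum>l\<in>full_columns. exp ((- \<i> * y * of_nat (e l)) / of_nat q)) *
      (\<Prod>i\<in>{1..d}. (\<Sum>k<q. exp ((- \<i> * y * of_nat (\<delta> i)) * of_nat k / of_nat q)) / of_nat q)" for q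
  proof -
    have "{x. x \<in> B \<and> fst x \<in> full_columns \<and> snd x \<in> exponent_box d (\<lambda>_. q)} = full_columns \<times> exponent_box d (\<lambda>_. q)"
      by (auto simp: full_columns_def exponent_box_def)
    then have "main q = (\<Sum>(l, b)\<in>full_columns \<times> exponent_box d (\<lambda>_. q). ?E q (weight \<delta> d b + e l))"
      unfolding main_def by (simp add: case_prod_beta)
    also have "\<dots> = (\<Sum>(l, b)\<in>full_columns \<times> exponent_box d (\<lambda>_. q). exp ((- \<i> * y * of_nat (e l)) / of_nat q) *
        (\<Prod>i\<in>{1..d}. exp ((- \<i> * y * of_nat (\<delta> i)) * of_nat (b i) / of_nat q)))"
    proof (intro sum.cong refl, clarify)
      fix l b
      have "- \<i> * y * of_nat (weight \<delta> d b + e l) / of_nat q =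
         (- \<i> * y * of_nat (e l)) / of_nat q + (\<Sum>i\<in>{1..d}. (- \<i> * y * of_nat (\<delta> i)) * of_nat (b i) / of_nat q)"
        by (simp add: weight_def add_divide_distrib distrib_left sum_distrib_left sum_divide_distrib mult.assoc diff_divide_distrib sum_negf)
      then show "?E q (weight \<delta> d b + e l) = exp ((- \<i> * y * of_nat (e l)) / of_nat q) *
        (\<Prod>i\<in>{1..d}. exp ((- \<i> * y * of_nat (\<delta> i)) * of_nat (b i) / of_nat q))"
        by (simp only: exp_add exp_sum finite_atLeastAtMost)
    qed
    also have "\<dots> = (\<Sum>l\<in>full_columns. exp ((- \<i> * y * of_nat (e l)) / of_nat q)) *
        (\<Sum>b\<in>exponent_box d (\<lambda>_. q). \<Prod>i\<in>{1..d}. exp ((- \<i> * y * of_nat (\<delta> i)) * of_nat (b i) / of_nat q))"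
      by (simp only: sum_product sum.cartesian_product)
    also have "(\<Sum>b\<in>exponent_box d (\<lambda>_. q). \<Prod>i\<in>{1..d}. exp ((- \<i> * y * of_nat (\<delta> i)) * of_nat (b i) / of_nat q)) =
        (\<Prod>i\<in>{1..d}. \<Sum>k<q. exp ((- \<i> * y * of_nat (\<delta> i)) * of_nat k / of_nat q))"
      by (rule sum_exponent_box[where g = "\<lambda>i k. exp ((- \<i> * y * of_nat (\<delta> i)) * of_nat k / of_nat q)"])
    finally show ?thesis
      by (simp add: prod_dividef power_divide)
  qed
  have unit: "(\<lambda>q. exp (c / of_nat q)) \<longlonglongrightarrow> 1" for c :: complex
    using tendsto_exp[OF lim_const_over_n[of c]] by simp
  have "(\<lambda>q. (1 / of_nat q) ^ d * main q) \<longlonglongrightarrow> (\<Sum>l\<in>full_columns. 1) * (\<Prod>i\<in>{1..d}. \<phi> i)"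
    unfolding main by (intro tendsto_mult tendsto_sum tendsto_prod unit \<phi>) auto
  from tendsto_add[OF diff this] show ?thesis
    by (simp add: generic_rank_def \<phi>_def algebra_simps)
qed

end

section \<open>Lengths of chains of subspaces\<close>

lemma chain_height_le_iff:
  "chain_height S \<le> enat N \<longleftrightarrow>
    (\<forall>n C. (\<forall>i\<le>n. C i \<in> S) \<and> (\<forall>i<n. C i \<subset> C (Suc i)) \<longrightarrow> n \<le> N)"
  unfolding chain_height_def Sup_le_iff by (auto; metis enat_ord_simps(1))

lemma chain_height_ge:
  "\<lbrakk>\<And>i. i \<le> n \<Longrightarrow> C i \<in> S; \<And>i. i < n \<Longrightarrow> C i \<subset> C (Suc i)\<rbrakk> \<Longrightarrow> enat n \<le> chain_height S"
  unfolding chain_height_def by (intro Sup_upper) blast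

text \<open>A chain recorded together with its last member, so that chains can be built one step at a time.\<close>

definition chain_to :: "'a set set \<Rightarrow> nat \<Rightarrow> 'a set \<Rightarrow> bool" where
  "chain_to S n E \<longleftrightarrow> (\<exists>C. (\<forall>i\<le>n. C i \<in> S) \<and> (\<forall>i<n. C i \<subset> C (Suc i)) \<and> C n = E)"

lemma chain_to_0: "E \<in> S \<Longrightarrow> chain_to S 0 E"
  by (auto simp: chain_to_def)

lemma chain_to_Suc:
  assumes "chain_to S n E" "F \<in> S" "E \<subset> F"
  shows "chain_to S (Suc n) F"
proof -
  obtain C where C: "\<forall>i\<le>n. C i \<in> S" "\<forall>i<n. C i \<subset> C (Suc i)" "C n = E"
    using assms(1) unfolding chain_to_def by blast
  let ?C = "C(Suc n := F)"
  have "?C i \<in> S" if "i \<le> Suc n" for i using C(1) assms(2) that by (cases "i = Suc n") auto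
  moreover have "?C i \<subset> ?C (Suc i)" if "i < Suc n" for i
    using C(2,3) assms(3) that by (cases "i = n") auto
  ultimately show ?thesis unfolding chain_to_def by (intro exI[of _ ?C]) simp
qed

lemma chain_to_mono: "\<lbrakk>chain_to S n E; \<And>F. F \<in> S \<Longrightarrow> F \<subseteq> E \<Longrightarrow> F \<in> T\<rbrakk> \<Longrightarrow> chain_to T n E"
  unfolding chain_to_def
proof (elim exE conjE)
  fix C assume T: "\<And>F. F \<in> S \<Longrightarrow> F \<subseteq> E \<Longrightarrow> F \<in> T"
    and C: "\<forall>i\<le>n. C i \<in> S" "\<forall>i<n. C i \<subset> C (Suc i)" "C n = E"
  have "C i \<subseteq> E" if "i \<le> n" for i
    using that
  proof (induction rule: inc_induct)
    case (step i) then show ?case using C(2) by blast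
  qed (simp add: C(3))
  then show "\<exists>C. (\<forall>i\<le>n. C i \<in> T) \<and> (\<forall>i<n. C i \<subset> C (Suc i)) \<and> C n = E"
    using C T by (intro exI[of _ C]) simp
qed

lemma chain_to_height: "chain_to S n E \<Longrightarrow> enat n \<le> chain_height S"
  unfolding chain_to_def using chain_height_ge[of n _ S] by blast

lemma chain_height_mono_map:
  assumes "\<And>P. P \<in> S \<Longrightarrow> \<phi> P \<in> T"
    and "\<And>P Y. \<lbrakk>P \<in> S; Y \<in> S; P \<subset> Y\<rbrakk> \<Longrightarrow> \<phi> P \<subset> \<phi> Y"
  shows "chain_height S \<le> chain_height T"
  unfolding chain_height_def
proof (rule Sup_mono, clarify)
  fix n C assume C: "\<forall>i\<le>n. C i \<in> S" "\<forall>i<n. C i \<subset> C (Suc i)"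
  show "\<exists>b\<in>{enat n |n. \<exists>C. (\<forall>i\<le>n. C i \<in> T) \<and> (\<forall>i<n. C i \<subset> C (Suc i))}. enat n \<le> b"
  proof (intro bexI[of _ "enat n"] CollectI exI[of _ n] exI[of _ "\<lambda>i. \<phi> (C i)"] conjI allI impI refl order_refl)
    fix i
    { assume "i \<le> n" then show "\<phi> (C i) \<in> T" using C assms(1) by blast }
    { assume "i < n" then show "\<phi> (C i) \<subset> \<phi> (C (Suc i))" using C assms(2) by simp }
  qed
qed

text \<open>The pieces of a graded ring over a field \<open>K\<close> are \<open>K\<close>-subspaces of the ring itself, so linear algebra is
  done inside the ring; a subalgebra in the sense of \<open>subalgebra\<close> is just a \<open>K\<close>-subspace.\<close>

locale ring_over_subfield = ring R for K and R (structure) +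
  assumes subfield_K: "subfield K R"
begin

abbreviation subsp :: "'a set \<Rightarrow> bool" where
  "subsp V \<equiv> subalgebra K V R"

abbreviation lin_span :: "'a set \<Rightarrow> 'a set" where
  "lin_span S \<equiv> subsp hull S"

lemma K_carrier: "K \<subseteq> carrier R"
  using subfield_K subring.axioms(1) subfieldE(3) by blast

lemma subspI:
  assumes "V \<subseteq> carrier R" "\<zero> \<in> V" "\<And>x y. \<lbrakk>x \<in> V; y \<in> V\<rbrakk> \<Longrightarrow> x \<oplus> y \<in> V"
    "\<And>a x. \<lbrakk>a \<in> K; x \<in> V\<rbrakk> \<Longrightarrow> a \<otimes> x \<in> V"
  shows "subsp V"
proof (intro subalgebra.intro subalgebra_axioms.intro add.subgroupI)
  have "\<ominus> \<one> \<in> K" using subfield_K subringE(3,5) subfieldE(1) subfield.axioms(1) subdomainE(5,3) by metis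
  then have "\<ominus> \<one> \<otimes> x \<in> V" if "x \<in> V" for x using assms(4) that by blast
  then show "\<ominus> x \<in> V" if "x \<in> V" for x using that assms(1) by (metis l_minus l_one one_closed subsetD)
qed (use assms in auto)

lemma subspD:
  assumes "subsp V"
  shows "V \<subseteq> carrier R" "\<zero> \<in> V" "\<And>x y. \<lbrakk>x \<in> V; y \<in> V\<rbrakk> \<Longrightarrow> x \<oplus> y \<in> V"
    "\<And>a x. \<lbrakk>a \<in> K; x \<in> V\<rbrakk> \<Longrightarrow> a \<otimes> x \<in> V" "\<And>x. x \<in> V \<Longrightarrow> \<ominus> x \<in> V"
    "\<And>x y. \<lbrakk>x \<in> V; y \<in> V\<rbrakk> \<Longrightarrow> x \<ominus> y \<in> V"
proof -
  interpret V: subgroup V "add_monoid R" using assms by (rule subalgebra.axioms(1))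
  show c: "V \<subseteq> carrier R" using V.subset by simp
  show "\<zero> \<in> V" using V.one_closed by simp
  show add: "\<And>x y. \<lbrakk>x \<in> V; y \<in> V\<rbrakk> \<Longrightarrow> x \<oplus> y \<in> V" using V.m_closed by simp
  show "\<And>a x. \<lbrakk>a \<in> K; x \<in> V\<rbrakk> \<Longrightarrow> a \<otimes> x \<in> V" using subalgebra.smult_closed[OF assms] by blast
  show neg: "\<And>x. x \<in> V \<Longrightarrow> \<ominus> x \<in> V" using V.m_inv_closed by (simp add: a_inv_def)
  show "\<And>x y. \<lbrakk>x \<in> V; y \<in> V\<rbrakk> \<Longrightarrow> x \<ominus> y \<in> V" using add neg by (simp add: a_minus_def)
qed

lemma subsp_carrier: "subsp (carrier R)"
  by (rule subspI) (use K_carrier in auto)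

lemma subsp_lin_span:
  assumes "S \<subseteq> carrier R"
  shows "subsp (lin_span S)"
proof (rule subspI)
  show "lin_span S \<subseteq> carrier R" by (rule hull_minimal[where S = subsp, OF assms subsp_carrier])
qed (auto simp: hull_def dest: subspD)

lemma lin_span_subset_iff: "subsp V \<Longrightarrow> lin_span S \<subseteq> V \<longleftrightarrow> S \<subseteq> V"
  by (rule subset_hull)

lemma subsp_line_extension:
  assumes "subsp V" "w \<in> carrier R"
  shows "subsp (line_extension K w V)"
proof -
  have sg: "subgroup V (add_monoid R)" using assms(1) subalgebra.axioms(1) by blast
  show ?thesis
    using line_extension_is_subgroup[OF subfield_K sg assms(2)]
      line_extension_smult_closed[OF subfield_K subalgebra.smult_closed[OF assms(1)] subspD(1)[OF assms(1)] assms(2)]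
    by (intro subalgebra.intro subalgebra_axioms.intro) auto
qed

lemma lin_span_insert_subset:
  assumes "subsp V" "w \<in> carrier R"
  shows "lin_span (insert w V) \<subseteq> line_extension K w V"
proof (rule hull_minimal[where S = subsp, OF _ subsp_line_extension[OF assms]], rule insert_subsetI)
  have K01: "\<zero> \<in> K" "\<one> \<in> K"
    using subfield_K by (simp_all add: subdomainE(2,3) subfield.axioms(1))
  show "w \<in> line_extension K w V"
    unfolding line_extension_mem_iff using assms subspD(2)[OF assms(1)] K01
    by (intro bexI[of _ \<one>] bexI[of _ \<zero>]) auto
  show "V \<subseteq> line_extension K w V"
  proof
    fix t assume t: "t \<in> V"
    then have "t = \<zero> \<otimes> w \<oplus> t" using assms(2) subspD(1)[OF assms(1)] by auto
    then show "t \<in> line_extension K w V" unfolding line_extension_mem_iff using K01(1) t by blast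
  qed
qed

lemma exchange:
  assumes V: "subsp V" and w: "w \<in> carrier R" and v: "v \<in> lin_span (insert w V)" "v \<notin> V"
  shows "w \<in> lin_span (insert v V)"
proof -
  obtain k u where k: "k \<in> K" "u \<in> V" "v = k \<otimes> w \<oplus> u"
    using subsetD[OF lin_span_insert_subset[OF V w] v(1)] unfolding line_extension_mem_iff by blast
  have c: "k \<in> carrier R" "u \<in> carrier R" using k K_carrier subspD(1)[OF V] by auto
  have vc: "v \<in> carrier R" using k c w by simp
  have S: "subsp (lin_span (insert v V))" using vc subspD(1)[OF V] by (intro subsp_lin_span) auto
  have "k \<noteq> \<zero>" using k v(2) c w by auto
  then have inv: "inv k \<in> K" "inv k \<otimes> k = \<one>" "inv k \<in> carrier R"
    using subfield_m_inv[OF subfield_K, of k] k K_carrier by auto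
  have "v \<ominus> u = k \<otimes> w" unfolding k(3) using c w by (simp add: a_minus_def a_assoc r_neg)
  then have "inv k \<otimes> (v \<ominus> u) = w" using inv c w by (simp flip: m_assoc)
  moreover have "v \<ominus> u \<in> lin_span (insert v V)"
    using k by (intro subspD(6)[OF S]) (auto intro: hull_inc)
  ultimately show ?thesis using subspD(4)[OF S inv(1)] by metis
qed

text \<open>When the elements of \<open>W\<close> are added to \<open>V\<close> one at a time, \<open>v\<close> enters the span at some step. The element added
  at that step can be exchanged for \<open>v\<close>.\<close>

lemma exchange_set:
  assumes "finite W" "W \<subseteq> carrier R" "subsp V" "v \<in> lin_span (V \<union> W)" "v \<notin> V"
  shows "\<exists>w\<in>W. w \<in> lin_span (V \<union> {v} \<union> (W - {w}))"
  using assms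
proof (induction W rule: finite_induct)
  case empty
  then show ?case by (simp add: hull_same)
next
  case (insert w W)
  have VW: "V \<union> W \<subseteq> carrier R" using insert.prems subspD(1) by auto
  show ?case
  proof (cases "v \<in> lin_span (V \<union> W)")
    case True
    then obtain w' where w': "w' \<in> W" "w' \<in> lin_span (V \<union> {v} \<union> (W - {w'}))"
      using insert by auto
    have "lin_span (V \<union> {v} \<union> (W - {w'})) \<subseteq> lin_span (V \<union> {v} \<union> (insert w W - {w'}))"
      by (rule hull_mono) auto
    then show ?thesis using w' by blast
  next
    case False
    have "lin_span (V \<union> insert w W) = lin_span (insert w (lin_span (V \<union> W)))"
      by (simp flip: hull_insert)
    then have v: "v \<in> lin_span (insert w (lin_span (V \<union> W)))" using insert.prems(3) by simp
    have "w \<in> lin_span (insert v (lin_span (V \<union> W)))"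
      by (rule exchange[OF subsp_lin_span[OF VW] _ v False]) (use insert.prems(1) in simp)
    also have "\<dots> = lin_span (insert v (V \<union> W))" by (simp flip: hull_insert)
    also have "insert v (V \<union> W) = V \<union> {v} \<union> (insert w W - {w})" using insert.hyps by auto
    finally show ?thesis by blast
  qed
qed

text \<open>Steinitz exchange, formulated for chains: the first step of the chain makes one of the elements of \<open>W\<close>
  superfluous.\<close>

lemma chain_length_le_card:
  assumes "finite W" "W \<subseteq> carrier R" "\<And>i. i \<le> N \<Longrightarrow> subsp (C i)" "\<And>i. i < N \<Longrightarrow> C i \<subset> C (Suc i)"
    "C N \<subseteq> lin_span (C 0 \<union> W)"
  shows "N \<le> card W"
  using assms
proof (induction N arbitrary: C W)
  case 0 then show ?case by simp
next
  case (Suc N)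
  obtain v where v: "v \<in> C 1" "v \<notin> C 0" using Suc.prems(4)[of 0] by auto
  have mono: "C 1 \<subseteq> C (Suc n)" if "n \<le> N" for n
    using that
  proof (induction n)
    case (Suc n)
    then show ?case using Suc.prems(1) \<open>\<And>i. i < Suc N \<Longrightarrow> C i \<subset> C (Suc i)\<close>[of "Suc n"] by auto
  qed simp
  have C1: "C 1 \<subseteq> carrier R" using Suc.prems(3)[of 1] subspD(1) by auto
  have C01: "C 0 \<subseteq> C 1" using Suc.prems(4)[of 0] by auto
  have "v \<in> lin_span (C 0 \<union> W)" using v(1) mono[of N] Suc.prems(5) by blast
  then obtain w where w: "w \<in> W" "w \<in> lin_span (C 0 \<union> {v} \<union> (W - {w}))"
    using exchange_set[of W "C 0" v] v(2) Suc.prems(1-3) by blast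
  have sub: "subsp (lin_span (C 1 \<union> (W - {w})))"
    using C1 Suc.prems(2) by (intro subsp_lin_span) auto
  have "lin_span (C 0 \<union> {v} \<union> (W - {w})) \<subseteq> lin_span (C 1 \<union> (W - {w}))"
    by (rule hull_mono) (use C01 v in auto)
  then have "C 0 \<union> W \<subseteq> lin_span (C 1 \<union> (W - {w}))"
    using w C01 hull_subset[of "C 1 \<union> (W - {w})" subsp] by blast
  then have "lin_span (C 0 \<union> W) \<subseteq> lin_span (C 1 \<union> (W - {w}))"
    using lin_span_subset_iff[OF sub] by blast
  then have "N \<le> card (W - {w})"
    using Suc.prems by (intro Suc.IH[of _ "\<lambda>i. C (Suc i)"]) auto
  then show ?case using w Suc.prems(1) by (metis Suc_le_mono card_Suc_Diff1)
qed

text \<open>For subspaces \<open>U \<subseteq> V\<close> this is the dimension of \<open>V/U\<close>, in the form in which module lengths are defined. Spanning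
  sets bound it from above, and chains bound it from below.\<close>

definition rel_length :: "'a set \<Rightarrow> 'a set \<Rightarrow> enat" where
  "rel_length U V = chain_height {E. subsp E \<and> U \<subseteq> E \<and> E \<subseteq> V}"

lemma rel_length_le_card:
  assumes "finite W" "W \<subseteq> carrier R" "U \<subseteq> carrier R" "V \<subseteq> lin_span (U \<union> W)"
  shows "rel_length U V \<le> enat (card W)"
  unfolding rel_length_def chain_height_le_iff
proof (intro allI impI, elim conjE)
  fix n C
  assume C: "\<forall>i\<le>n. C i \<in> {E. subsp E \<and> U \<subseteq> E \<and> E \<subseteq> V}" "\<forall>i<n. C i \<subset> C (Suc i)"
  have "lin_span (U \<union> W) \<subseteq> lin_span (C 0 \<union> W)" by (rule hull_mono) (use C in auto)
  then have "C n \<subseteq> lin_span (C 0 \<union> W)" using C assms(4) by blast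
  then show "n \<le> card W" using C by (intro chain_length_le_card[OF assms(1,2), of n C]) auto
qed

text \<open>Adding a vector outside the current span lengthens a chain that starts at \<open>U\<close>, so the process stops
  within \<open>N\<close> steps.\<close>

lemma rel_length_spanning_set:
  assumes "subsp U" "subsp V" "U \<subseteq> V" "rel_length U V \<le> enat N"
  shows "\<exists>W. finite W \<and> W \<subseteq> V \<and> card W \<le> N \<and> V \<subseteq> lin_span (U \<union> W)"
proof (rule ccontr)
  assume nex: "\<not> (\<exists>W. finite W \<and> W \<subseteq> V \<and> card W \<le> N \<and> V \<subseteq> lin_span (U \<union> W))"
  have neg: "\<not> V \<subseteq> lin_span (U \<union> W)" if "finite W" "W \<subseteq> V" "card W \<le> N" for W
  proof
    assume "V \<subseteq> lin_span (U \<union> W)"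
    with that have "\<exists>W. finite W \<and> W \<subseteq> V \<and> card W \<le> N \<and> V \<subseteq> lin_span (U \<union> W)"
      by (intro exI[of _ W] conjI)
    with nex show False by (rule notE)
  qed
  let ?S = "{E. subsp E \<and> U \<subseteq> E \<and> E \<subseteq> V}"
  have "\<exists>W. finite W \<and> W \<subseteq> V \<and> card W \<le> n \<and> chain_to ?S n (lin_span (U \<union> W))" if "n \<le> Suc N" for n
    using that
  proof (induction n)
    case 0
    have "lin_span U = U" by (rule hull_same[where S = subsp]) fact
    then have "chain_to ?S 0 (lin_span (U \<union> {}))" using assms by (intro chain_to_0) simp
    then show ?case by (intro exI[of _ "{}"]) simp
  next
    case (Suc n)
    then obtain W where W: "finite W" "W \<subseteq> V" "card W \<le> n" "chain_to ?S n (lin_span (U \<union> W))" by auto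
    have "\<not> V \<subseteq> lin_span (U \<union> W)" using W Suc.prems by (intro neg) auto
    then obtain w where w: "w \<in> V" "w \<notin> lin_span (U \<union> W)" by blast
    let ?W = "insert w W"
    have sub: "U \<union> ?W \<subseteq> V" using w W assms by auto
    have inc: "U \<union> ?W \<subseteq> lin_span (U \<union> ?W)" by (rule hull_subset)
    have "lin_span (U \<union> ?W) \<subseteq> V" using sub lin_span_subset_iff[OF assms(2)] by simp
    moreover have "subsp (lin_span (U \<union> ?W))" using sub subspD(1)[OF assms(2)] by (intro subsp_lin_span) auto
    ultimately have "lin_span (U \<union> ?W) \<in> ?S" using inc by simp
    moreover have "lin_span (U \<union> W) \<subset> lin_span (U \<union> ?W)"
    proof
      show "lin_span (U \<union> W) \<subseteq> lin_span (U \<union> ?W)" by (rule hull_mono) auto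
      show "lin_span (U \<union> W) \<noteq> lin_span (U \<union> ?W)" using w(2) inc by auto
    qed
    ultimately have "chain_to ?S (Suc n) (lin_span (U \<union> ?W))" using W(4) by (intro chain_to_Suc[of _ n])
    moreover have "card ?W \<le> Suc n" using W by (simp add: card_insert_if)
    moreover have "finite ?W" "?W \<subseteq> V" using W w by auto
    ultimately show ?case by (intro exI[of _ ?W] conjI)
  qed
  from this[OF order_refl] have "enat (Suc N) \<le> rel_length U V"
    unfolding rel_length_def using chain_to_height by metis
  then show False using assms(4) by (metis enat_ord_simps(1) not_less_eq_eq order_refl order_trans)
qed

text \<open>The vectors that survive when a family is reduced from the bottom up along \<open>lt\<close>.\<close>

definition standard :: "('i \<Rightarrow> 'i \<Rightarrow> bool) \<Rightarrow> ('i \<Rightarrow> 'a) \<Rightarrow> 'i set \<Rightarrow> 'i set" where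
  "standard lt v P = {x \<in> P. v x \<notin> lin_span (v ` {y \<in> P. lt y x})}"

text \<open>Adding the vectors in increasing order, the span grows precisely at the standard ones; so these span,
  and the spans of initial segments form a chain of length equal to their number.\<close>

lemma standard_chain:
  assumes "finite P" "v ` P \<subseteq> carrier R" "transp lt" "asymp lt" "totalp_on P lt"
  shows "lin_span (v ` standard lt v P) = lin_span (v ` P)"
    and "enat (card (standard lt v P)) \<le> rel_length {\<zero>} (lin_span (v ` P))"
proof -
  have "lin_span (v ` standard lt v P) = lin_span (v ` P) \<and>
     chain_to (Collect subsp) (card (standard lt v P)) (lin_span (v ` P))"
    using assms(1,2,5)
  proof (induction "card P" arbitrary: P)
    case 0
    then have P: "P = {}" by simp
    have "subsp (lin_span {})" by (rule subsp_lin_span) simp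
    then show ?case by (simp add: P standard_def chain_to_0)
  next
    case (Suc n)
    have "P \<noteq> {}" using Suc.hyps by auto
    moreover have tr: "transp_on P lt" by (rule transp_on_subset[OF assms(3)]) simp
    ultimately obtain m where m: "m \<in> P" "\<And>x. \<lbrakk>x \<in> P; x \<noteq> m\<rbrakk> \<Longrightarrow> lt x m"
      using Finite_Set.bex_greatest_element[OF Suc.prems(1) _ tr Suc.prems(3)] by blast
    let ?Y = "P - {m}"
    have asym: "\<not> lt y x" if "lt x y" for x y by (rule asympD[of lt, OF assms(4) that])
    then have irr: "\<not> lt m m" by blast
    have noless: "\<not> lt m y" if "y \<in> ?Y" for y
      using m(2)[of y] that asym[of y m] by simp
    have below: "{y \<in> P. lt y m} = ?Y" using m irr by auto
    have below': "{y \<in> P. lt y x} = {y \<in> ?Y. lt y x}" if "x \<in> ?Y" for x using noless[OF that] by auto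
    have std: "standard lt v P = standard lt v ?Y \<union> (if v m \<in> lin_span (v ` ?Y) then {} else {m})"
    proof (rule Set.set_eqI)
      fix x
      show "x \<in> standard lt v P \<longleftrightarrow> x \<in> standard lt v ?Y \<union> (if v m \<in> lin_span (v ` ?Y) then {} else {m})"
      proof (cases "x = m")
        case True then show ?thesis using m(1) by (simp add: standard_def below)
      next
        case False
        have "x \<in> standard lt v P \<longleftrightarrow> x \<in> standard lt v ?Y"
        proof (cases "x \<in> P")
          case True
          then have Y: "x \<in> ?Y" using False by simp
          show ?thesis unfolding standard_def mem_Collect_eq below'[OF Y] using True Y by blast
        qed (simp add: standard_def)
        then show ?thesis using False by simp
      qed
    qed
    have fin: "finite (standard lt v ?Y)" using Suc.prems by (simp add: standard_def)
    have mY: "m \<notin> standard lt v ?Y" by (auto simp: standard_def)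
    have "n = card ?Y" using Suc.hyps Suc.prems m(1) by simp
    moreover have "totalp_on ?Y lt" by (rule totalp_on_subset[OF Suc.prems(3)]) auto
    ultimately have IH: "lin_span (v ` standard lt v ?Y) = lin_span (v ` ?Y)"
     "chain_to (Collect subsp) (card (standard lt v ?Y)) (lin_span (v ` ?Y))"
      using Suc.hyps(1)[of ?Y] Suc.prems by auto
    have vP: "v ` P = insert (v m) (v ` ?Y)" using m(1) by auto
    show ?case
    proof (cases "v m \<in> lin_span (v ` ?Y)")
      case True
      then have "lin_span (v ` P) = lin_span (v ` ?Y)" unfolding vP by (rule hull_redundant)
      then show ?thesis using IH std True by simp
    next
      case False
      have stdP: "standard lt v P = insert m (standard lt v ?Y)" using std False by simp
      then have c: "card (standard lt v P) = Suc (card (standard lt v ?Y))" using fin mY by simp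
      have "lin_span (v ` standard lt v P) = lin_span (insert (v m) (lin_span (v ` standard lt v ?Y)))"
        unfolding stdP by (simp flip: hull_insert)
      also have "\<dots> = lin_span (v ` P)" unfolding IH(1) vP by (simp flip: hull_insert)
      finally have 1: "lin_span (v ` standard lt v P) = lin_span (v ` P)" .
      have "lin_span (v ` ?Y) \<subset> lin_span (v ` P)"
      proof
        show "lin_span (v ` ?Y) \<subseteq> lin_span (v ` P)" by (rule hull_mono) auto
        show "lin_span (v ` ?Y) \<noteq> lin_span (v ` P)" using False hull_inc[of "v m" "v ` P" subsp] m(1) by auto
      qed
      moreover have "subsp (lin_span (v ` P))" by (rule subsp_lin_span) fact
      ultimately show ?thesis unfolding c using 1 IH(2) by (auto intro: chain_to_Suc)
    qed
  qed
  then show "lin_span (v ` standard lt v P) = lin_span (v ` P)"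
    and "enat (card (standard lt v P)) \<le> rel_length {\<zero>} (lin_span (v ` P))"
    unfolding rel_length_def by (auto intro!: chain_to_height elim!: chain_to_mono dest: subspD(2))
qed

lemma rel_length_zero_eq_card_standard:
  assumes "finite P" "v ` P \<subseteq> carrier R" "transp lt" "asymp lt" "totalp_on P lt"
  shows "rel_length {\<zero>} (lin_span (v ` P)) = enat (card (standard lt v P))"
proof (rule antisym)
  have fin: "finite (standard lt v P)" using assms(1) by (simp add: standard_def)
  have "v ` standard lt v P \<subseteq> carrier R" using assms(2) by (auto simp: standard_def)
  moreover have "lin_span (v ` P) \<subseteq> lin_span ({\<zero>} \<union> v ` standard lt v P)"
    unfolding standard_chain(1)[OF assms, symmetric] by (rule hull_mono) auto
  ultimately have "rel_length {\<zero>} (lin_span (v ` P)) \<le> enat (card (v ` standard lt v P))"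
    using fin by (intro rel_length_le_card) auto
  also have "\<dots> \<le> enat (card (standard lt v P))" using card_image_le[OF fin] by simp
  finally show "rel_length {\<zero>} (lin_span (v ` P)) \<le> enat (card (standard lt v P))" .
qed (rule standard_chain(2)[OF assms])

end

section \<open>Homogeneous components and graded ideals\<close>

locale graded_algebra = nat_graded_ring R A for R (structure) and A +
  assumes field_A0: "field (R\<lparr>carrier := A 0\<rparr>)"
begin

lemma A_carrier: "A n \<subseteq> carrier R"
  by (rule additive_subgroup.a_subset[OF piece_subgroup])

lemma A_closed: "x \<in> A n \<Longrightarrow> x \<in> carrier R"
  using A_carrier by blast

lemma A_zero: "\<zero> \<in> A n"
  by (rule additive_subgroup.zero_closed[OF piece_subgroup])

lemma A_add: "\<lbrakk>x \<in> A n; y \<in> A n\<rbrakk> \<Longrightarrow> x \<oplus> y \<in> A n"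
  by (rule additive_subgroup.a_closed[OF piece_subgroup])

lemma one_A0: "\<one> \<in> A 0"
proof -
  interpret F: field "R\<lparr>carrier := A 0\<rparr>" by (rule field_A0)
  show ?thesis using F.one_closed by simp
qed

lemma A_scalar: "\<lbrakk>a \<in> A 0; x \<in> A n\<rbrakk> \<Longrightarrow> a \<otimes> x \<in> A n"
  using piece_mult[of a 0 x n] by simp

end

sublocale graded_algebra \<subseteq> ring_over_subfield "A 0" R
  by (intro ring_over_subfield.intro ring_over_subfield_axioms.intro ring_axioms subfield_iff(1)[OF field_A0 A_carrier])

context graded_algebra
begin

lemma subsp_A: "subsp (A n)"
  by (rule subspI) (auto intro: A_closed A_zero A_add A_scalar)

lemma lin_span_subset_A: "S \<subseteq> A n \<Longrightarrow> lin_span S \<subseteq> A n"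
  using lin_span_subset_iff[OF subsp_A] by blast

definition component :: "'a \<Rightarrow> nat \<Rightarrow> 'a" where
  "component x = (THE c. (\<forall>n. c n \<in> A n) \<and> finite {n. c n \<noteq> \<zero>} \<and> x = (\<Oplus>n\<in>{n. c n \<noteq> \<zero>}. c n))"

lemma
  assumes "x \<in> carrier R"
  shows component_A: "component x n \<in> A n" and finite_component: "finite {n. component x n \<noteq> \<zero>}"
    and component_sum: "x = (\<Oplus>n\<in>{n. component x n \<noteq> \<zero>}. component x n)"
  using theI'[OF piece_decomp[OF assms]] unfolding component_def[symmetric] by blast+

lemma component_carrier: "x \<in> carrier R \<Longrightarrow> component x n \<in> carrier R"
  using component_A A_closed by blast

lemma finsum_support:
  assumes "\<And>n. c n \<in> carrier R" "finite F" "\<And>n. n \<notin> F \<Longrightarrow> c n = \<zero>"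
  shows "(\<Oplus>n\<in>{n. c n \<noteq> \<zero>}. c n) = (\<Oplus>n\<in>F. c n)"
  by (rule add.finprod_mono_neutral_cong_left) (use assms in auto)

lemma component_eqI:
  assumes "\<And>n. c n \<in> A n" "finite F" "\<And>n. n \<notin> F \<Longrightarrow> c n = \<zero>" "x = (\<Oplus>n\<in>F. c n)"
  shows "component x = c"
proof -
  have c: "c n \<in> carrier R" for n using assms(1) A_closed by blast
  have x: "x \<in> carrier R" unfolding assms(4) using c by (intro finsum_closed) auto
  have "finite {n. c n \<noteq> \<zero>}" by (rule finite_subset[OF _ assms(2)]) (use assms(3) in blast)
  moreover have "x = (\<Oplus>n\<in>{n. c n \<noteq> \<zero>}. c n)"
    unfolding assms(4) by (rule finsum_support[symmetric, OF c assms(2,3)])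
  ultimately show ?thesis
    unfolding component_def using assms(1) by (intro the1_equality[OF piece_decomp[OF x]]) blast
qed

lemma component_add:
  assumes "x \<in> carrier R" "y \<in> carrier R"
  shows "component (x \<oplus> y) n = component x n \<oplus> component y n"
proof -
  let ?F = "{n. component x n \<noteq> \<zero>} \<union> {n. component y n \<noteq> \<zero>}"
  have fin: "finite ?F" using assms finite_component by blast
  have "component (x \<oplus> y) = (\<lambda>n. component x n \<oplus> component y n)"
  proof (rule component_eqI[OF _ fin])
    have "(\<Oplus>n\<in>?F. component x n) = x"
      by (rule trans[OF finsum_support[OF component_carrier[OF assms(1)] fin, symmetric] component_sum[OF assms(1), symmetric]]) simp
    moreover have "(\<Oplus>n\<in>?F. component y n) = y"
      by (rule trans[OF finsum_support[OF component_carrier[OF assms(2)] fin, symmetric] component_sum[OF assms(2), symmetric]]) simp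
    moreover have "(\<Oplus>n\<in>?F. component x n \<oplus> component y n) = (\<Oplus>n\<in>?F. component x n) \<oplus> (\<Oplus>n\<in>?F. component y n)"
      using component_carrier assms by (intro finsum_addf) auto
    ultimately show "x \<oplus> y = (\<Oplus>n\<in>?F. component x n \<oplus> component y n)" by simp
    show "component x n \<oplus> component y n \<in> A n" for n by (intro A_add component_A assms)
    show "component x n \<oplus> component y n = \<zero>" if "n \<notin> ?F" for n using that by simp
  qed
  then show ?thesis by simp
qed

lemma component_homogeneous:
  assumes "x \<in> A m"
  shows "component x n = (if n = m then x else \<zero>)"
proof -
  have "component x = (\<lambda>n. if n = m then x else \<zero>)"
    by (rule component_eqI[of _ "{m}"]) (use assms A_zero A_closed in auto)
  then show ?thesis by simp
qed

lemma component_mult: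
  assumes "a \<in> A m" "x \<in> carrier R"
  shows "component (a \<otimes> x) n = (if m \<le> n then a \<otimes> component x (n - m) else \<zero>)"
proof -
  let ?S = "{n. component x n \<noteq> \<zero>}" and ?c = "\<lambda>n. if m \<le> n then a \<otimes> component x (n - m) else \<zero>"
  have a: "a \<in> carrier R" using assms(1) A_closed by blast
  have fin: "finite ?S" using assms(2) by (rule finite_component)
  have "component (a \<otimes> x) = ?c"
  proof (rule component_eqI[where F = "(\<lambda>n. n + m) ` ?S"])
    show "?c n \<in> A n" for n
      using piece_mult[OF assms(1) component_A[OF assms(2)], of "n - m"] A_zero by auto
    show "?c n = \<zero>" if "n \<notin> (\<lambda>n. n + m) ` ?S" for n
    proof (cases "m \<le> n")
      case True
      then have "component x (n - m) = \<zero>" using that by (force simp: image_iff)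
      then show ?thesis using a by simp
    qed simp
    have "a \<otimes> x = a \<otimes> (\<Oplus>n\<in>?S. component x n)" by (rule arg_cong[OF component_sum[OF assms(2)]])
    also have "\<dots> = (\<Oplus>n\<in>?S. a \<otimes> component x n)"
      using a component_carrier[OF assms(2)] fin by (intro finsum_rdistr) auto
    also have "\<dots> = (\<Oplus>n\<in>?S. ?c (n + m))" by simp
    also have "\<dots> = (\<Oplus>n\<in>(\<lambda>n. n + m) ` ?S. ?c n)"
      using a component_carrier[OF assms(2)] by (subst finsum_reindex) (auto simp: inj_on_def)
    finally show "a \<otimes> x = (\<Oplus>n\<in>(\<lambda>n. n + m) ` ?S. ?c n)" .
  qed (use fin in auto)
  then show ?thesis by simp
qed

text \<open>Additive properties need only be checked on homogeneous elements.\<close>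

lemma homogeneous_induct [consumes 1, case_names homogeneous add]:
  assumes "x \<in> carrier R" "\<And>n a. a \<in> A n \<Longrightarrow> Q a"
    "\<And>a b. \<lbrakk>a \<in> carrier R; b \<in> carrier R; Q a; Q b\<rbrakk> \<Longrightarrow> Q (a \<oplus> b)"
  shows "Q x"
proof -
  have "Q (\<Oplus>n\<in>F. component x n)" if "finite F" for F
    using that
  proof (induction F rule: finite_induct)
    case empty
    show ?case using assms(2)[OF A_zero] by simp
  next
    case (insert n F)
    then show ?case using assms component_carrier[OF assms(1)] component_A[OF assms(1), of n]
      by (subst finsum_insert) (auto intro!: finsum_closed assms(3))
  qed
  then show ?thesis using component_sum[OF assms(1)] finite_component[OF assms(1)] by metis
qed

text \<open>Ideals are constructed degree by degree: a family of subspaces that is stable under homogeneous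
  multiplication prescribes the values that the components may take.\<close>

lemma graded_ideal:
  assumes V: "\<And>n. subsp (V n)" "\<And>m n a x. \<lbrakk>a \<in> A m; x \<in> V n\<rbrakk> \<Longrightarrow> a \<otimes> x \<in> V (m + n)"
  shows "ideal {x \<in> carrier R. \<forall>n. component x n \<in> V n} R" (is "ideal ?J R")
proof -
  have V0: "\<zero> \<in> V n" for n using V(1) by (rule subspD)
  have homog: "a \<otimes> x \<in> ?J" if "a \<in> A m" "x \<in> ?J" for a m x
  proof -
    have "component (a \<otimes> x) n \<in> V n" for n
    proof (cases "m \<le> n")
      case True
      then show ?thesis using V(2)[OF that(1), of "component x (n - m)" "n - m"] that by (simp add: component_mult)
    qed (use that V0 in \<open>simp add: component_mult\<close>)
    then show ?thesis using that A_closed by auto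
  qed
  have sub: "subsp ?J"
  proof (rule subspI)
    show "\<zero> \<in> ?J" using V0 component_homogeneous[OF A_zero, of _ 0] by simp
    show "x \<oplus> y \<in> ?J" if "x \<in> ?J" "y \<in> ?J" for x y
      using that subspD(3)[OF V(1)] by (simp add: component_add)
  qed (use homog in auto)
  have mult: "a \<otimes> x \<in> ?J" if "a \<in> carrier R" "x \<in> ?J" for a x
    using that(1)
  proof (induction a rule: homogeneous_induct)
    case (add a b)
    then show ?case using that(2) subspD(3)[OF sub add(3,4)] by (simp add: l_distr)
  qed (use homog that(2) in blast)
  show ?thesis
  proof (rule idealI[OF ring_axioms])
    show "subgroup ?J (add_monoid R)" using sub by (rule subalgebra.axioms(1))
    fix a x assume ax: "a \<in> ?J" "x \<in> carrier R"
    show l: "x \<otimes> a \<in> ?J" by (rule mult[OF ax(2,1)])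
    have "a \<otimes> x = x \<otimes> a" using ax by (intro m_comm) auto
    then show "a \<otimes> x \<in> ?J" using l by (simp only:)
  qed
qed

lemma subsp_ideal: "ideal J R \<Longrightarrow> subsp J"
  by (rule ideal_is_subalgebra[OF K_carrier])

lemma subsp_Int: "\<lbrakk>subsp U; subsp V\<rbrakk> \<Longrightarrow> subsp (U \<inter> V)"
  by (rule subalgebra_inter)

lemma mult_lin_span:
  assumes "a \<in> carrier R" "S \<subseteq> carrier R" "x \<in> lin_span S"
  shows "a \<otimes> x \<in> lin_span ((\<otimes>) a ` S)"
proof -
  have c: "(\<otimes>) a ` S \<subseteq> carrier R" using assms by auto
  have s: "subsp (lin_span ((\<otimes>) a ` S))" by (rule subsp_lin_span[OF c])
  have "subsp {x \<in> carrier R. a \<otimes> x \<in> lin_span ((\<otimes>) a ` S)}"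
  proof (rule subspI)
    fix k x assume k: "k \<in> A 0" and x: "x \<in> {x \<in> carrier R. a \<otimes> x \<in> lin_span ((\<otimes>) a ` S)}"
    then have "a \<otimes> (k \<otimes> x) = k \<otimes> (a \<otimes> x)" using assms(1) A_closed m_lcomm by auto
    then show "k \<otimes> x \<in> {x \<in> carrier R. a \<otimes> x \<in> lin_span ((\<otimes>) a ` S)}"
      using k x subspD(4)[OF s k] A_closed[OF k] by auto
  qed (use assms(1) subspD(2,3)[OF s] in \<open>auto simp: r_distr\<close>)
  moreover have "S \<subseteq> {x \<in> carrier R. a \<otimes> x \<in> lin_span ((\<otimes>) a ` S)}"
    using assms(2) by (auto intro: hull_inc)
  ultimately have "lin_span S \<subseteq> {x \<in> carrier R. a \<otimes> x \<in> lin_span ((\<otimes>) a ` S)}"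
    using lin_span_subset_iff by blast
  then show ?thesis using assms(3) by blast
qed

text \<open>The obvious spanning set in degree \<open>j\<close> of the ideal generated by the homogeneous elements \<open>g i\<close> of
  degrees \<open>e i\<close>.\<close>

definition multiples :: "nat \<Rightarrow> (nat \<Rightarrow> 'a) \<Rightarrow> (nat \<Rightarrow> nat) \<Rightarrow> nat \<Rightarrow> 'a set" where
  "multiples d g e j = {g i \<otimes> a | i a. i \<in> {1..d} \<and> e i \<le> j \<and> a \<in> A (j - e i)}"

lemma multiples_A:
  assumes "\<And>i. i \<in> {1..d} \<Longrightarrow> g i \<in> A (e i)"
  shows "multiples d g e j \<subseteq> A j"
  using assms piece_mult by (fastforce simp: multiples_def)

text \<open>The elements all of whose components lie in the spans of \<open>multiples\<close> form an ideal that contains the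
  generators, hence contains the generated ideal.\<close>

lemma component_ideal_in_lin_span_multiples:
  assumes g: "\<And>i. i \<in> {1..d} \<Longrightarrow> g i \<in> A (e i)" and x: "x \<in> Idl (g ` {1..d})"
  shows "component x j \<in> lin_span (multiples d g e j)"
proof -
  let ?V = "\<lambda>j. lin_span (multiples d g e j)"
  have mc: "multiples d g e j \<subseteq> carrier R" for j
    by (rule order_trans[OF multiples_A A_carrier], rule g)
  have sub: "subsp (?V j)" for j
    by (rule subsp_lin_span[OF mc])
  have "ideal {x \<in> carrier R. \<forall>n. component x n \<in> ?V n} R"
  proof (rule graded_ideal[OF sub])
    fix m n a x assume a: "a \<in> A m" and x: "x \<in> ?V n"
    have "a \<otimes> x \<in> lin_span ((\<otimes>) a ` multiples d g e n)"
      by (rule mult_lin_span[OF A_closed[OF a] mc x])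
    also have "\<dots> \<subseteq> ?V (m + n)"
    proof (rule hull_mono, clarsimp simp: multiples_def)
      fix i b assume ib: "Suc 0 \<le> i" "i \<le> d" "e i \<le> n" "b \<in> A (n - e i)"
      have "g i \<in> carrier R" "b \<in> carrier R" "a \<in> carrier R" using g[of i] ib a A_closed by auto
      then have "a \<otimes> (g i \<otimes> b) = g i \<otimes> (a \<otimes> b)" by (simp add: m_lcomm)
      moreover have "a \<otimes> b \<in> A (m + n - e i)" using piece_mult[OF a ib(4)] ib(3) by simp
      ultimately show "\<exists>i' b'. a \<otimes> (g i \<otimes> b) = g i' \<otimes> b' \<and> Suc 0 \<le> i' \<and> i' \<le> d \<and> e i' \<le> m + n \<and> b' \<in> A (m + n - e i')"
        using ib by (intro exI[of _ i] exI[of _ "a \<otimes> b"]) auto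
    qed
    finally show "a \<otimes> x \<in> ?V (m + n)" .
  qed
  moreover have "g ` {1..d} \<subseteq> {x \<in> carrier R. \<forall>n. component x n \<in> ?V n}"
  proof clarify
    fix i assume i: "i \<in> {1..d}"
    have gi: "g i \<in> carrier R" using g[OF i] A_closed by blast
    have "g i \<in> multiples d g e (e i)"
      unfolding multiples_def using i one_A0 gi by (auto intro!: exI[of _ i] exI[of _ \<one>])
    then show "g i \<in> carrier R \<and> (\<forall>n. component (g i) n \<in> ?V n)"
      using gi component_homogeneous[OF g[OF i]] subspD(2)[OF sub] by (auto intro: hull_inc)
  qed
  ultimately have "Idl (g ` {1..d}) \<subseteq> {x \<in> carrier R. \<forall>n. component x n \<in> ?V n}"
    by (rule genideal_minimal)
  then show ?thesis using x by blast
qed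

lemma gens_carrier: "(\<And>i. i \<in> {1..d} \<Longrightarrow> g i \<in> A (e i)) \<Longrightarrow> g ` {1..d} \<subseteq> carrier R"
  using A_closed by blast

lemma lin_span_multiples_ideal:
  assumes g: "\<And>i. i \<in> {1..d} \<Longrightarrow> g i \<in> A (e i)"
  shows "lin_span (multiples d g e j) \<subseteq> Idl (g ` {1..d}) \<inter> A j"
proof -
  have I: "ideal (Idl (g ` {1..d})) R" by (intro genideal_ideal gens_carrier[OF g])
  have "multiples d g e j \<subseteq> Idl (g ` {1..d})"
  proof
    fix x assume "x \<in> multiples d g e j"
    then obtain i a where x: "x = g i \<otimes> a" "i \<in> {1..d}" "a \<in> A (j - e i)"
      unfolding multiples_def by blast
    have "g ` {1..d} \<subseteq> Idl (g ` {1..d})" by (intro genideal_self gens_carrier[OF g])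
    then have "g i \<in> Idl (g ` {1..d})" using x(2) by blast
    then show "x \<in> Idl (g ` {1..d})" unfolding x(1) by (rule ideal.I_r_closed[OF I _ A_closed[OF x(3)]])
  qed
  moreover have "multiples d g e j \<subseteq> A j" by (rule multiples_A[OF g])
  ultimately show ?thesis
    by (intro iffD2[OF lin_span_subset_iff[OF subsp_Int[OF subsp_ideal[OF I] subsp_A]]] Int_greatest)
qed

lemma ideal_piece:
  assumes g: "\<And>i. i \<in> {1..d} \<Longrightarrow> g i \<in> A (e i)"
  shows "Idl (g ` {1..d}) \<inter> A j = lin_span (multiples d g e j)"
proof
  show "Idl (g ` {1..d}) \<inter> A j \<subseteq> lin_span (multiples d g e j)"
  proof
    fix x assume x: "x \<in> Idl (g ` {1..d}) \<inter> A j"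
    have "component x j \<in> lin_span (multiples d g e j)"
      by (rule component_ideal_in_lin_span_multiples) (use g x in auto)
    moreover have "component x j = x" using component_homogeneous[of x j j] x by simp
    ultimately show "x \<in> lin_span (multiples d g e j)" by simp
  qed
qed (rule lin_span_multiples_ideal[OF g])

lemma component_in_ideal:
  fixes d :: nat
  assumes "\<And>i. i \<in> {1..d} \<Longrightarrow> g i \<in> A (e i)" "x \<in> Idl (g ` {1..d})"
  shows "component x j \<in> Idl (g ` {1..d})"
proof -
  have "component x j \<in> lin_span (multiples d g e j)" by (rule component_ideal_in_lin_span_multiples) (use assms in auto)
  moreover have "lin_span (multiples d g e j) \<subseteq> Idl (g ` {1..d}) \<inter> A j" by (rule lin_span_multiples_ideal) (use assms in auto)
  ultimately show ?thesis by blast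
qed

section \<open>Monomials and the graded Nakayama lemma\<close>

definition monomial :: "nat \<Rightarrow> (nat \<Rightarrow> 'a) \<Rightarrow> (nat \<Rightarrow> nat) \<Rightarrow> 'a" where
  "monomial d g b = (\<Otimes>i\<in>{1..d}. g i [^] b i)"

lemma monomial_carrier: "g ` {1..d} \<subseteq> carrier R \<Longrightarrow> monomial d g b \<in> carrier R"
  unfolding monomial_def by (intro finprod_closed) auto

lemma monomial_zero: "monomial d g (\<lambda>_. 0) = \<one>"
  by (simp add: monomial_def)

lemma monomial_add:
  assumes "g ` {1..d} \<subseteq> carrier R"
  shows "monomial d g (\<lambda>i. b i + c i) = monomial d g b \<otimes> monomial d g c"
proof -
  have "monomial d g (\<lambda>i. b i + c i) = (\<Otimes>i\<in>{1..d}. g i [^] b i \<otimes> g i [^] c i)"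
    unfolding monomial_def using assms by (intro finprod_cong') (auto simp: nat_pow_mult image_subset_iff)
  also have "\<dots> = monomial d g b \<otimes> monomial d g c"
    unfolding monomial_def using assms by (intro finprod_multf) auto
  finally show ?thesis .
qed

lemma monomial_single:
  assumes "g ` {1..d} \<subseteq> carrier R" "i \<in> {1..d}"
  shows "monomial d g (\<lambda>j. if j = i then n else 0) = g i [^] n"
proof -
  have "monomial d g (\<lambda>j. if j = i then n else 0) = (\<Otimes>j\<in>{1..d}. if i = j then g j [^] n else \<one>)"
    unfolding monomial_def using assms by (intro finprod_cong') auto
  also have "\<dots> = g i [^] n"
    using assms by (intro finprod_singleton) auto
  finally show ?thesis .
qed

lemma pow_A: "x \<in> A n \<Longrightarrow> x [^] (k::nat) \<in> A (n * k)"
proof (induction k)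
  case 0 then show ?case by (simp add: one_A0)
next
  case (Suc k)
  then show ?case using piece_mult[OF Suc.IH[OF Suc.prems] Suc.prems] by (simp add: add.commute)
qed

lemma monomial_A:
  assumes "\<And>i. i \<in> {1..d} \<Longrightarrow> g i \<in> A (e i)"
  shows "monomial d g b \<in> A (weight e d b)"
proof -
  have "(\<Otimes>i\<in>S. g i [^] b i) \<in> A (\<Sum>i\<in>S. e i * b i)" if "finite S" "S \<subseteq> {1..d}" for S
    using that
  proof (induction S rule: finite_induct)
    case (insert i S)
    have c: "g j [^] b j \<in> carrier R" if "j \<in> insert i S" for j
      using assms A_closed that insert.prems by (intro nat_pow_closed) blast
    have "g i [^] b i \<in> A (e i * b i)" using assms insert.prems by (intro pow_A) blast
    then show ?case using insert c piece_mult by (simp add: Pi_def)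
  qed (simp add: one_A0)
  from this[of "{1..d}"] show ?thesis by (simp add: monomial_def weight_def)
qed

text \<open>Positivity of the degrees makes this an induction on \<open>j\<close>: the part of degree \<open>j\<close> in the ideal is
  spanned by products of generators with elements of smaller degree. The same statement serves for
  the parameters and for their \<open>q\<close>-th powers.\<close>

theorem graded_Nakayama:
  assumes g: "\<And>i. i \<in> {1..d} \<Longrightarrow> g i \<in> A (e i)" and e: "\<And>i. i \<in> {1..d} \<Longrightarrow> e i > 0"
    and W: "\<And>j. W j \<subseteq> A j" "\<And>j. A j \<subseteq> lin_span (W j \<union> multiples d g e j)"
  shows "A j \<subseteq> lin_span {monomial d g c \<otimes> w | c w. c \<in> exponents d \<and> weight e d c \<le> j \<and> w \<in> W (j - weight e d c)}"
proof (induction j rule: less_induct)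
  case (less j)
  let ?T = "\<lambda>j. {monomial d g c \<otimes> w | c w. c \<in> exponents d \<and> weight e d c \<le> j \<and> w \<in> W (j - weight e d c)}"
  have gc: "g ` {1..d} \<subseteq> carrier R" by (rule gens_carrier[OF g])
  have Tc: "?T j \<subseteq> carrier R" for j
    using monomial_carrier[OF gc] W(1) A_closed by blast
  have sub: "subsp (lin_span (?T j))" by (rule subsp_lin_span[OF Tc])
  have "W j \<subseteq> lin_span (?T j)"
  proof
    fix w assume w: "w \<in> W j"
    have "w \<in> carrier R" using w W(1) A_closed by blast
    then have "w = monomial d g (\<lambda>_. 0) \<otimes> w" by (simp add: monomial_zero)
    moreover have "(\<lambda>_. 0) \<in> exponents d" "weight e d (\<lambda>_. 0) = 0" by (simp_all add: exponents_def weight_def)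
    ultimately have "w \<in> ?T j" using w by force
    then show "w \<in> lin_span (?T j)" by (rule hull_inc)
  qed
  moreover have "multiples d g e j \<subseteq> lin_span (?T j)"
  proof
    fix x assume "x \<in> multiples d g e j"
    then obtain i a where x: "x = g i \<otimes> a" "i \<in> {1..d}" "e i \<le> j" "a \<in> A (j - e i)"
      unfolding multiples_def by blast
    have "a \<in> lin_span (?T (j - e i))" using less[of "j - e i"] x(3,4) e[OF x(2)] by auto
    then have "x \<in> lin_span ((\<otimes>) (g i) ` ?T (j - e i))"
      unfolding x(1) by (intro mult_lin_span[OF _ Tc]) (use gc x(2) in auto)
    also have "\<dots> \<subseteq> lin_span (?T j)"
    proof (rule hull_mono, rule image_subsetI)
      fix y assume "y \<in> ?T (j - e i)"
      then obtain c w where y: "y = monomial d g c \<otimes> w" "c \<in> exponents d" "weight e d c \<le> j - e i" "w \<in> W (j - e i - weight e d c)"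
        by blast
      let ?c = "\<lambda>k. (if k = i then 1 else 0) + c k"
      have "weight e d (\<lambda>k. if k = i then 1 else 0) = e i"
        using x(2) unfolding weight_def by (simp add: if_distrib[of "(*) (e _)"] cong: if_cong)
      then have "weight e d ?c = e i + weight e d c" by (simp only: weight_add)
      moreover have "?c \<in> exponents d" using y(2) x(2) by (auto simp: exponents_def)
      moreover have "g i \<otimes> y = monomial d g ?c \<otimes> w"
      proof -
        have "g i = monomial d g (\<lambda>k. if k = i then 1 else 0)"
          using monomial_single[OF gc x(2), of 1] gc x(2) by (auto simp: image_subset_iff)
        moreover have "w \<in> carrier R" using y(4) W(1) A_closed by blast
        ultimately show ?thesis
          unfolding y(1) by (simp only: monomial_add[OF gc] m_assoc[OF monomial_carrier[OF gc] monomial_carrier[OF gc]])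
      qed
      ultimately show "g i \<otimes> y \<in> ?T j"
        using y(3,4) x(3) by (auto intro!: exI[of _ ?c] exI[of _ w])
    qed
    finally show "x \<in> lin_span (?T j)" .
  qed
  ultimately have "lin_span (W j \<union> multiples d g e j) \<subseteq> lin_span (?T j)"
    using lin_span_subset_iff[OF sub] by blast
  then show ?case using W(2) by blast
qed

end

section \<open>Module lengths of graded pieces and of quotients\<close>

lemma zero_FactRing: "\<zero>\<^bsub>R Quot I\<^esub> = I"
  by (simp add: FactRing_def)

lemma submodule_module_on_iff:
  fixes S (structure)
  assumes "abelian_group S" "subgroup V (add_monoid S)"
  shows "submodule N K (module_on S V s) \<longleftrightarrow>
    subgroup N (add_monoid S) \<and> N \<subseteq> V \<and> (\<forall>a\<in>carrier K. \<forall>x\<in>N. s a x \<in> N)"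
proof -
  interpret S: abelian_group S by fact
  interpret V: subgroup V "add_monoid S" by fact
  have inv: "inv\<^bsub>add_monoid (module_on S V s)\<^esub> x = \<ominus> x" if "x \<in> V" for x
  proof -
    have "\<ominus> x \<in> V" using V.m_inv_closed[OF that] by (simp add: a_inv_def)
    moreover have "x \<in> carrier S" using that V.subset by auto
    ultimately show ?thesis
      using V.subset S.minus_unique[of _ x]
      unfolding m_inv_def module_on_def
      by (intro the_equality) (auto simp: S.r_neg S.l_neg)
  qed
  have inv': "inv\<^bsub>add_monoid S\<^esub> x = \<ominus> x" for x by (simp add: a_inv_def)
  have "subgroup N (add_monoid (module_on S V s)) \<longleftrightarrow> subgroup N (add_monoid S) \<and> N \<subseteq> V"
    unfolding subgroup_def inv' using inv V.subset
    by (auto simp: module_on_def[of S V s] subset_iff)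
  then show ?thesis
    unfolding submodule_def submodule_axioms_def by (auto simp: module_on_def)
qed

context ring_over_subfield
begin

text \<open>Covers both \<open>R_0\<close>-submodules of a single piece of \<open>R/I\<close> and \<open>R\<close>-submodules of the whole quotient, through the
  choice of \<open>S\<close> and \<open>E\<close>.\<close>

lemma quotient_image_submodule:
  assumes I: "ideal I R" and E: "subgroup E (add_monoid R)" and V: "subgroup V (add_monoid R)" "V \<subseteq> E"
    and S: "carrier S \<subseteq> carrier R" "\<And>a x. \<lbrakk>a \<in> carrier S; x \<in> V\<rbrakk> \<Longrightarrow> a \<otimes> x \<in> V"
  shows "submodule ((+>) I ` V) S (module_on (R Quot I) ((+>) I ` E) (quot_smult R I))"
proof -
  interpret h: ring_hom_ring R "R Quot I" "(+>) I" by (rule ideal.rcos_ring_hom_ring[OF I])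
  have sub: "subgroup ((+>) I ` U) (add_monoid (R Quot I))" if "subgroup U (add_monoid R)" for U
    using group_hom.subgroup_img_is_subgroup[OF h.a_group_hom that] by simp
  have "quot_smult R I a c \<in> (+>) I ` V" if a: "a \<in> carrier S" and c: "c \<in> (+>) I ` V" for a c
  proof -
    obtain x where x: "x \<in> V" "c = I +> x" using c by blast
    have "x \<in> carrier R" "a \<in> carrier R" using subgroup.subset[OF V(1)] x a S(1) by auto
    then have "quot_smult R I a c = I +> (a \<otimes> x)" unfolding quot_smult_def x(2) by (simp only: h.hom_mult)
    then show ?thesis using S(2)[OF a x(1)] by blast
  qed
  then show ?thesis
    by (intro iffD2[OF submodule_module_on_iff[OF h.S.abelian_group_axioms sub[OF E]]] conjI ballI
        sub[OF V(1)] image_mono[OF V(2)])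
qed

lemma quotient_class_eq_iff:
  assumes "ideal I R" "x \<in> carrier R" "y \<in> carrier R"
  shows "I +> x = I +> y \<longleftrightarrow> x \<ominus> y \<in> I"
  by (rule quotient_eq_iff_same_a_r_cos[OF assms, symmetric])

lemma quotient_image_strict_mono:
  assumes I: "ideal I R" and U: "subgroup U (add_monoid R)" "subgroup V (add_monoid R)" "U \<subset> V" "I \<inter> V \<subseteq> U"
  shows "(+>) I ` U \<subset> (+>) I ` V"
proof -
  obtain x where x: "x \<in> V" "x \<notin> U" using U(3) by blast
  have xc: "x \<in> carrier R" using x(1) subgroup.subset[OF U(2)] by auto
  have "I +> x \<notin> (+>) I ` U"
  proof
    assume "I +> x \<in> (+>) I ` U"
    then obtain u where u: "u \<in> U" "I +> x = I +> u" by blast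
    have uc: "u \<in> carrier R" using u(1) subgroup.subset[OF U(1)] by auto
    have "x \<ominus> u \<in> I" using u(2) quotient_class_eq_iff[OF I xc uc] by simp
    moreover have "\<ominus> u \<in> V" using subgroup.m_inv_closed[OF U(2), of u] u(1) U(3) by (auto simp: a_inv_def)
    then have "x \<ominus> u \<in> V" using subgroup.m_closed[OF U(2) x(1)] by (simp add: a_minus_def)
    ultimately have "x \<ominus> u \<in> U" using U(4) by blast
    then have "(x \<ominus> u) \<oplus> u \<in> U" using subgroup.m_closed[OF U(1), of "x \<ominus> u" u] u(1) by simp
    moreover have "(x \<ominus> u) \<oplus> u = x" using xc uc by (simp add: a_minus_def a_assoc l_neg)
    ultimately show False using x(2) by simp
  qed
  then show ?thesis using U(3) x(1) by blast
qed

end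

context graded_algebra
begin

lemma subgroup_A: "subgroup (A n) (add_monoid R)"
  by (rule additive_subgroup.a_subgroup[OF piece_subgroup])

lemma subsp_iff: "subsp V \<longleftrightarrow> subgroup V (add_monoid R) \<and> (\<forall>a\<in>A 0. \<forall>x\<in>V. a \<otimes> x \<in> V)"
  unfolding subalgebra_def subalgebra_axioms_def by blast

lemma module_length_piece: "module_length (degree_zero_ring R A) (piece R A j) = rel_length {\<zero>} (A j)"
proof -
  have "submodule N (degree_zero_ring R A) (piece R A j) \<longleftrightarrow> subsp N \<and> {\<zero>} \<subseteq> N \<and> N \<subseteq> A j" for N
    unfolding piece_def submodule_module_on_iff[OF abelian_group_axioms subgroup_A] subsp_iff
    using subgroup.one_closed[of N "add_monoid R"] by (auto simp: degree_zero_ring_def)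
  then show ?thesis by (simp add: module_length_def rel_length_def)
qed

text \<open>Submodules of a piece of \<open>R/I\<close> correspond to subspaces between \<open>I \<inter> A j\<close> and \<open>A j\<close>, by taking images and
  preimages under the quotient map.\<close>

lemma module_length_quot_piece:
  assumes I: "ideal I R"
  shows "module_length (degree_zero_ring R A) (quot_piece R A I j) = rel_length (I \<inter> A j) (A j)"
proof -
  interpret h: ring_hom_ring R "R Quot I" "(+>) I" by (rule ideal.rcos_ring_hom_ring[OF I])
  let ?T = "{N. submodule N (degree_zero_ring R A) (quot_piece R A I j)}"
  let ?S = "{E. subsp E \<and> I \<inter> A j \<subseteq> E \<and> E \<subseteq> A j}"
  have carr: "carrier (degree_zero_ring R A) = A 0" by (simp add: degree_zero_ring_def)
  have "chain_height ?S \<le> chain_height ?T"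
  proof (rule chain_height_mono_map[where \<phi> = "(`) ((+>) I)"])
    fix E assume "E \<in> ?S"
    then show "(+>) I ` E \<in> ?T"
      unfolding quot_piece_def mem_Collect_eq using A_carrier
      by (intro quotient_image_submodule I subgroup_A) (auto simp: subsp_iff carr)
  next
    fix E F assume "E \<in> ?S" "F \<in> ?S" "E \<subset> F"
    then show "(+>) I ` E \<subset> (+>) I ` F"
      by (intro quotient_image_strict_mono I) (auto simp: subsp_iff)
  qed
  moreover have "chain_height ?T \<le> chain_height ?S"
  proof (rule chain_height_mono_map[where \<phi> = "\<lambda>N. {x \<in> A j. I +> x \<in> N}"])
    have img: "subgroup ((+>) I ` A j) (add_monoid (R Quot I))"
      using group_hom.subgroup_img_is_subgroup[OF h.a_group_hom subgroup_A] by simp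
    have T: "N \<in> ?T \<longleftrightarrow> subgroup N (add_monoid (R Quot I)) \<and> N \<subseteq> (+>) I ` A j \<and>
        (\<forall>a\<in>A 0. \<forall>x\<in>N. quot_smult R I a x \<in> N)" for N
      unfolding quot_piece_def mem_Collect_eq submodule_module_on_iff[OF h.S.abelian_group_axioms img] carr ..
    {
      fix N assume N: "N \<in> ?T"
      then have sub: "subgroup N (add_monoid (R Quot I))" and smult: "\<And>a x. \<lbrakk>a \<in> A 0; x \<in> N\<rbrakk> \<Longrightarrow> quot_smult R I a x \<in> N"
        unfolding T by blast+
      have "\<zero>\<^bsub>R Quot I\<^esub> \<in> N" using subgroup.one_closed[OF sub] by simp
      then have zero: "I \<in> N" by (simp only: zero_FactRing)
      have "subsp {x \<in> A j. I +> x \<in> N}"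
      proof (rule subspI)
        have "I +> \<zero> = I" using ideal.axioms(1)[OF I, THEN additive_subgroup.zero_closed] by (rule a_rcos_zero[OF I])
        then show "\<zero> \<in> {x \<in> A j. I +> x \<in> N}" using A_zero zero by simp
        show "x \<oplus> y \<in> {x \<in> A j. I +> x \<in> N}" if "x \<in> {x \<in> A j. I +> x \<in> N}" "y \<in> {x \<in> A j. I +> x \<in> N}" for x y
        proof -
          have c: "x \<in> carrier R" "y \<in> carrier R" using that A_closed by auto
          have "(I +> x) \<oplus>\<^bsub>R Quot I\<^esub> (I +> y) \<in> N" using subgroup.m_closed[OF sub, of "I +> x" "I +> y"] that by simp
          then show ?thesis using that A_add h.hom_add[OF c] by simp
        qed
        show "a \<otimes> x \<in> {x \<in> A j. I +> x \<in> N}" if "a \<in> A 0" "x \<in> {x \<in> A j. I +> x \<in> N}" for a x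
        proof -
          have c: "a \<in> carrier R" "x \<in> carrier R" using that A_closed by auto
          have "quot_smult R I a (I +> x) \<in> N" using smult that by blast
          then show ?thesis using that A_scalar h.hom_mult[OF c] by (simp add: quot_smult_def)
        qed
      qed (use A_closed in auto)
      moreover have "I \<inter> A j \<subseteq> {x \<in> A j. I +> x \<in> N}"
        using zero a_rcos_zero[OF I] by auto
      moreover have "{x \<in> A j. I +> x \<in> N} \<subseteq> A j" by auto
      ultimately show "{x \<in> A j. I +> x \<in> N} \<in> ?S" by (intro CollectI conjI)
    }
    fix M N assume MN: "M \<in> ?T" "N \<in> ?T" "M \<subset> N"
    then have "N \<subseteq> (+>) I ` A j" unfolding T by blast
    then show "{x \<in> A j. I +> x \<in> M} \<subset> {x \<in> A j. I +> x \<in> N}" using MN(3) by blast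
  qed
  ultimately show ?thesis unfolding module_length_def rel_length_def by (rule antisym[rotated])
qed

context
  fixes J :: "'a set"
  assumes J: "ideal J R" and J_component: "\<And>x n. x \<in> J \<Longrightarrow> component x n \<in> J"
begin

text \<open>The ideal that agrees with \<open>J\<close> below degree \<open>j\<close>, is \<open>V\<close> in degree \<open>j\<close> and everything above. Multiplication by an
  element of positive degree moves \<open>V\<close> into the unrestricted part, so any subspace \<open>V\<close> between
  \<open>J \<inter> A j\<close> and \<open>A j\<close> is allowed. In this way chains of vector spaces become chains of submodules of \<open>R/J\<close>, which
  is how finite length over \<open>R\<close> is turned into finite dimension over \<open>R_0\<close>.\<close>

definition layer :: "nat \<Rightarrow> 'a set \<Rightarrow> 'a set" where
  "layer j V = {x \<in> carrier R. \<forall>n. component x n \<in> (if n < j then J \<inter> A n else if n = j then V else A n)}"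

lemma layer_ideal:
  assumes "subsp V" "J \<inter> A j \<subseteq> V" "V \<subseteq> A j"
  shows "ideal (layer j V) R" "J \<subseteq> layer j V"
proof -
  show "ideal (layer j V) R"
    unfolding layer_def
  proof (rule graded_ideal)
    fix n
    show "subsp (if n < j then J \<inter> A n else if n = j then V else A n)"
      using assms(1) subsp_Int[OF subsp_ideal[OF J] subsp_A] subsp_A by simp
  next
    fix m n a x
    assume a: "a \<in> A m" and x: "x \<in> (if n < j then J \<inter> A n else if n = j then V else A n)"
    have xA: "x \<in> A n" using x assms(3) by (auto split: if_splits)
    have axA: "a \<otimes> x \<in> A (m + n)" using piece_mult[OF a xA] .
    have JA: "a \<otimes> x \<in> J" if "x \<in> J" by (rule ideal.I_l_closed[OF J that A_closed[OF a]])
    show "a \<otimes> x \<in> (if m + n < j then J \<inter> A (m + n) else if m + n = j then V else A (m + n))"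
    proof (cases "m = 0")
      case True
      then show ?thesis using x JA axA a subspD(4)[OF assms(1)] by (auto split: if_splits)
    next
      case False
      then have "x \<in> J" if "m + n \<le> j" using x that by (auto split: if_splits)
      then show ?thesis using JA axA assms(2) by auto
    qed
  qed
  show "J \<subseteq> layer j V"
  proof
    fix x assume x: "x \<in> J"
    then have c: "x \<in> carrier R" using additive_subgroup.a_subset[OF ideal.axioms(1)[OF J]] by blast
    then have "component x n \<in> J \<inter> A n" for n using J_component[OF x] component_A by blast
    then show "x \<in> layer j V" using c assms(2) by (auto simp: layer_def)
  qed
qed

lemma ideal_subgroup: "ideal U R \<Longrightarrow> subgroup U (add_monoid R)"
  by (intro additive_subgroup.a_subgroup ideal.axioms(1))

lemma layer_submodule:
  assumes "ideal U R"
  shows "submodule ((+>) J ` U) R (quot_module R J)"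
proof -
  have c: "carrier (R Quot J) = (+>) J ` carrier R"
    by (auto simp: FactRing_def A_RCOSETS_def' a_r_coset_def')
  have "subgroup (carrier R) (add_monoid R)" using subsp_carrier unfolding subsp_iff by blast
  moreover have "U \<subseteq> carrier R" using additive_subgroup.a_subset[OF ideal.axioms(1)[OF assms]] .
  ultimately show ?thesis
    unfolding quot_module_def c
    by (intro quotient_image_submodule J ideal_subgroup[OF assms]) (auto intro: ideal.I_l_closed[OF assms])
qed

lemma rel_length_le_module_length: "rel_length (J \<inter> A j) (A j) \<le> module_length R (quot_module R J)"
  unfolding rel_length_def module_length_def
proof (rule chain_height_mono_map[where \<phi> = "\<lambda>V. (+>) J ` layer j V"])
  fix V assume "V \<in> {E. subsp E \<and> J \<inter> A j \<subseteq> E \<and> E \<subseteq> A j}"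
  then show "(+>) J ` layer j V \<in> {N. submodule N R (quot_module R J)}"
    using layer_submodule layer_ideal(1) by blast
next
  fix U V assume U: "U \<in> {E. subsp E \<and> J \<inter> A j \<subseteq> E \<and> E \<subseteq> A j}" and V: "V \<in> {E. subsp E \<and> J \<inter> A j \<subseteq> E \<and> E \<subseteq> A j}"
    and UV: "U \<subset> V"
  obtain x where x: "x \<in> V" "x \<notin> U" using UV by blast
  then have xA: "x \<in> A j" using V by blast
  have "x \<in> layer j V" using x(1) xA A_closed[OF xA] A_zero subspD(2)[OF subsp_ideal[OF J]]
    by (auto simp: layer_def component_homogeneous[OF xA])
  moreover have "component x j \<notin> U" using x(2) component_homogeneous[OF xA] by simp
  then have "x \<notin> layer j U" by (auto simp: layer_def)
  moreover have "layer j U \<subseteq> layer j V"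
  proof
    fix z assume z: "z \<in> layer j U"
    then have "component z n \<in> (if n < j then J \<inter> A n else if n = j then V else A n)" for n
      using UV unfolding layer_def mem_Collect_eq by (cases n j rule: linorder_cases) (force split: if_splits)+
    then show "z \<in> layer j V" using z unfolding layer_def by simp
  qed
  ultimately have "layer j U \<subset> layer j V" by blast
  moreover have "J \<subseteq> layer j U" using layer_ideal(2) U by blast
  moreover have "ideal (layer j U) R" "ideal (layer j V) R" using layer_ideal(1) U V by blast+
  ultimately show "(+>) J ` layer j U \<subset> (+>) J ` layer j V"
    by (intro quotient_image_strict_mono J ideal_subgroup) auto
qed

text \<open>The ideals that impose the condition of \<open>J\<close> only below a given degree decrease strictly at each degree whose
  piece is not contained in \<open>J\<close>; infinitely many such degrees would contradict finite length.\<close>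

lemma eventually_piece_in_ideal:
  assumes "module_length R (quot_module R J) \<noteq> \<infinity>"
  shows "\<exists>n. \<forall>j\<ge>n. A j \<subseteq> J"
proof (rule ccontr)
  assume "\<nexists>n. \<forall>j\<ge>n. A j \<subseteq> J"
  then have inf: "infinite {j. \<not> A j \<subseteq> J}"
    unfolding infinite_nat_iff_unbounded_le by blast
  define D where "D = enumerate {j. \<not> A j \<subseteq> J}"
  have D: "\<not> A (D n) \<subseteq> J" "m < n \<Longrightarrow> D m < D n" for m n
    using enumerate_in_set[OF inf] enumerate_mono[OF _ inf] by (auto simp: D_def)
  define U where "U n = layer (D n) (A (D n))" for n
  have U: "ideal (U n) R" "J \<subseteq> U n" for n
    unfolding U_def by (intro layer_ideal subsp_A; simp)+
  have U_alt: "x \<in> U n \<longleftrightarrow> x \<in> carrier R \<and> (\<forall>k. component x k \<in> (if k < D n then J \<inter> A k else A k))" for x n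
    unfolding U_def layer_def by auto
  have step: "U (Suc n) \<subset> U n" for n
  proof -
    obtain x where x: "x \<in> A (D n)" "x \<notin> J" using D(1)[of n] by blast
    have "x \<in> U n" using x A_closed[OF x(1)] A_zero subspD(2)[OF subsp_ideal[OF J]]
      by (auto simp: U_alt component_homogeneous[OF x(1)])
    moreover have "component x (D n) \<notin> J" using x component_homogeneous[OF x(1)] by simp
    then have "x \<notin> U (Suc n)" using D(2)[of n "Suc n"] by (auto simp: U_alt)
    moreover have "U (Suc n) \<subseteq> U n"
    proof
      fix z assume z: "z \<in> U (Suc n)"
      have "component z k \<in> (if k < D n then J \<inter> A k else A k)" for k
        using z D(2)[of n "Suc n"] unfolding U_alt by (cases "k < D (Suc n)") (force split: if_splits)+
      then show "z \<in> U n" using z unfolding U_alt by simp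
    qed
    ultimately show ?thesis by blast
  qed
  have "enat M \<le> module_length R (quot_module R J)" for M
    unfolding module_length_def
  \<comment> \<open>The \<open>U\<close> decrease, so they are listed backwards to obtain an increasing chain.\<close>
  proof (rule chain_height_ge[where C = "\<lambda>i. (+>) J ` U (M - i)"])
    fix i assume "i < M"
    then have "U (M - i) \<subset> U (M - Suc i)" using step[of "M - Suc i"] by (simp add: Suc_diff_Suc)
    then show "(+>) J ` U (M - i) \<subset> (+>) J ` U (M - Suc i)"
      using U by (intro quotient_image_strict_mono J ideal_subgroup) auto
  qed (use layer_submodule U in blast)
  then show False using assms by (metis enat_ord_simps(1) not_infinity_eq not_less_eq_eq order_refl)
qed

end

end

section \<open>Frobenius powers of ideals\<close>

lemma (in cring) binomial_expansion:
  assumes a: "a \<in> carrier R" and b: "b \<in> carrier R"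
  shows "(a \<oplus> b) [^] n = (\<Oplus>k\<in>{..n}. add_pow R (n choose k) (a [^] k \<otimes> b [^] (n - k)))"
proof (induction n)
  case 0 then show ?case by simp
next
  case (Suc n)
  let ?t = "\<lambda>k m. a [^] (k::nat) \<otimes> b [^] (m::nat)"
  have t: "?t k m \<in> carrier R" for k m using a b by simp
  have "(a \<oplus> b) [^] Suc n = (\<Oplus>k\<in>{..n}. add_pow R (n choose k) (?t k (n - k))) \<otimes> a \<oplus> (\<Oplus>k\<in>{..n}. add_pow R (n choose k) (?t k (n - k))) \<otimes> b"
    using a b t by (simp add: Suc r_distr Pi_def)
  also have "(\<Oplus>k\<in>{..n}. add_pow R (n choose k) (?t k (n - k))) \<otimes> a = (\<Oplus>k\<in>{..n}. add_pow R (n choose k) (?t (Suc k) (n - k)))"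
  proof -
    have "(add_pow R (n choose k) (?t k (n - k))) \<otimes> a = add_pow R (n choose k) (?t (Suc k) (n - k))" for k
    proof -
      have "?t k (n - k) \<otimes> a = ?t (Suc k) (n - k)" using a b by (simp add: m_ac)
      then show ?thesis using t a by (simp add: add_pow_ldistr)
    qed
    then show ?thesis using t a by (simp add: finsum_ldistr Pi_def)
  qed
  also have "(\<Oplus>k\<in>{..n}. add_pow R (n choose k) (?t k (n - k))) \<otimes> b = (\<Oplus>k\<in>{..n}. add_pow R (n choose k) (?t k (Suc n - k)))"
  proof -
    have "(add_pow R (n choose k) (?t k (n - k))) \<otimes> b = add_pow R (n choose k) (?t k (Suc n - k))" if "k \<le> n" for k
    proof -
      have "?t k (n - k) \<otimes> b = ?t k (Suc n - k)" using a b that by (simp add: m_assoc Suc_diff_le)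
      then show ?thesis using t b by (simp add: add_pow_ldistr)
    qed
    then have "(\<Oplus>k\<in>{..n}. (add_pow R (n choose k) (?t k (n - k))) \<otimes> b) = (\<Oplus>k\<in>{..n}. add_pow R (n choose k) (?t k (Suc n - k)))"
      using t by (intro finsum_cong') auto
    then show ?thesis using t b by (simp add: finsum_ldistr Pi_def)
  qed
  also have "(\<Oplus>k\<in>{..n}. add_pow R (n choose k) (?t k (Suc n - k))) = (\<Oplus>k\<in>{..Suc n}. add_pow R (n choose k) (?t k (Suc n - k)))"
    using a b by (subst finsum_Suc) (auto simp: binomial_eq_0)
  also have "\<dots> = (\<Oplus>k\<in>{..n}. add_pow R (n choose Suc k) (?t (Suc k) (n - k))) \<oplus> ?t 0 (Suc n)"
    using a b by (subst finsum_Suc2) auto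
  also have "(\<Oplus>k\<in>{..n}. add_pow R (n choose k) (?t (Suc k) (n - k))) \<oplus> ((\<Oplus>k\<in>{..n}. add_pow R (n choose Suc k) (?t (Suc k) (n - k))) \<oplus> ?t 0 (Suc n))
      = (\<Oplus>k\<in>{..n}. add_pow R (n choose k) (?t (Suc k) (n - k)) \<oplus> add_pow R (n choose Suc k) (?t (Suc k) (n - k))) \<oplus> ?t 0 (Suc n)"
    using a b by (subst finsum_addf) (auto simp: a_assoc Pi_def)
  also have "\<dots> = (\<Oplus>k\<in>{..n}. add_pow R (Suc n choose Suc k) (?t (Suc k) (n - k))) \<oplus> ?t 0 (Suc n)"
    using a b by (simp add: add.nat_pow_mult)
  also have "\<dots> = (\<Oplus>k\<in>{..Suc n}. add_pow R (Suc n choose k) (?t k (Suc n - k)))"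
    using a b by (subst finsum_Suc2) auto
  finally show ?case .
qed

lemma (in cring) freshmans_dream:
  fixes p :: nat
  assumes p: "Factorial_Ring.prime p" and char: "add_pow R p \<one> = \<zero>" and a: "a \<in> carrier R" and b: "b \<in> carrier R"
  shows "(a \<oplus> b) [^] (p ^ n) = a [^] (p ^ n) \<oplus> b [^] (p ^ n)"
proof -
  have pz: "add_pow R p x = \<zero>" if "x \<in> carrier R" for x
    using add_pow_ldistr[of \<one> x p] that char by simp
  have one: "(a \<oplus> b) [^] p = a [^] p \<oplus> b [^] p" if a: "a \<in> carrier R" and b: "b \<in> carrier R" for a b
  proof -
    let ?s = "\<lambda>k. add_pow R (p choose k) (a [^] k \<otimes> b [^] (p - k))"
    have s: "?s k \<in> carrier R" for k using a b by simp
    have "?s k = \<zero>" if "k \<in> {..p} - {0, p}" for k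
    proof -
      have "p dvd p choose k" using that p by (intro dvd_choose_prime) auto
      then obtain m where m: "p choose k = p * m" by (auto elim: dvdE)
      have x: "a [^] k \<otimes> b [^] (p - k) \<in> carrier R" using a b by simp
      have "?s k = add_pow R m (add_pow R p (a [^] k \<otimes> b [^] (p - k)))"
        unfolding m using x by (simp add: add.nat_pow_pow)
      then show ?thesis using pz[OF x] by simp
    qed
    then have "(\<Oplus>k\<in>{0, p}. ?s k) = (\<Oplus>k\<in>{..p}. ?s k)"
      using s by (intro add.finprod_mono_neutral_cong_left) auto
    moreover have "(\<Oplus>k\<in>{0, p}. ?s k) = b [^] p \<oplus> a [^] p"
      using a b p by (subst finsum_insert) (auto simp: prime_gt_0_nat)
    ultimately show ?thesis using binomial_expansion[OF a b, of p] a b by (simp add: a_comm)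
  qed
  show ?thesis
  proof (induction n)
    case 0 then show ?case using a b by simp
  next
    case (Suc n)
    have "x [^] (p ^ Suc n) = (x [^] (p ^ n)) [^] p" if "x \<in> carrier R" for x
      using that by (simp add: nat_pow_pow mult.commute)
    then show ?case using Suc one a b by simp
  qed
qed

context graded_algebra
begin

lemma ring_char_prime:
  assumes "ring_char (R\<lparr>carrier := A 0\<rparr>) = p" "p > 0"
  shows "Factorial_Ring.prime p" and "add_pow R p \<one> = \<zero>"
proof -
  interpret F: field "R\<lparr>carrier := A 0\<rparr>" by (rule field_A0)
  have pow: "x [^]\<^bsub>add_monoid (R\<lparr>carrier := A 0\<rparr>)\<^esub> n = add_pow R n x" for x and n :: nat
    by (induction n) (simp_all add: add_pow_def nat_pow_def)
  have ord: "group.ord (add_monoid (R\<lparr>carrier := A 0\<rparr>)) \<one> = p"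
    using assms(1) by (simp add: ring_char_def)
  have dvd: "p dvd n \<longleftrightarrow> add_pow R n \<one> = \<zero>" for n :: nat
    using group.pow_eq_id[OF F.add.group_axioms, of \<one> n] one_A0 unfolding pow ord by simp
  show "add_pow R p \<one> = \<zero>" using dvd[of p] by simp
  have "prime_elem p"
  proof (rule prime_elemI)
    show "p \<noteq> 0" using assms(2) by simp
    show "\<not> p dvd 1" using dvd[of 1] F.one_not_zero by simp
    fix m n :: nat assume "p dvd m * n"
    then have "add_pow R (m * n) \<one> = \<zero>" using dvd by simp
    moreover have "(add_pow R m \<one>) \<otimes> (add_pow R n \<one>) = add_pow R (m * n) \<one>"
      by (simp add: add_pow_ldistr add.nat_pow_pow mult.commute)
    moreover have "add_pow R k \<one> \<in> A 0" for k :: nat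
      by (induction k) (simp_all add: A_zero A_add one_A0)
    ultimately have "add_pow R m \<one> = \<zero> \<or> add_pow R n \<one> = \<zero>" using F.integral[of "add_pow R m \<one>" "add_pow R n \<one>"] by simp
    then show "p dvd m \<or> p dvd n" using dvd by simp
  qed
  then show "Factorial_Ring.prime p" by simp
qed

text \<open>The elements whose \<open>p^n\<close>-th power lies in the ideal on the right form an ideal, because the Frobenius
  map is additive.\<close>

lemma frobenius_power_generators:
  fixes d :: nat
  assumes p: "Factorial_Ring.prime p" "add_pow R p \<one> = \<zero>" and f: "f ` {1..d} \<subseteq> carrier R"
  shows "frobenius_power R (Idl (f ` {1..d})) (p ^ n) = Idl ((\<lambda>i. f i [^] (p ^ n)) ` {1..d})"
proof -
  let ?q = "p ^ n" and ?I = "Idl (f ` {1..d})"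
  let ?J = "Idl ((\<lambda>i. f i [^] ?q) ` {1..d})"
  have fq: "(\<lambda>i. f i [^] ?q) ` {1..d} \<subseteq> carrier R" using f by auto
  have J: "ideal ?J R" by (rule genideal_ideal[OF fq])
  have I: "ideal ?I R" by (rule genideal_ideal[OF f])
  have Ic: "?I \<subseteq> carrier R" by (rule additive_subgroup.a_subset[OF ideal.axioms(1)[OF I]])
  have q0: "?q > 0" using p(1) prime_gt_0_nat by simp
  have Jsub: "subsp ?J" by (rule subsp_ideal[OF J])
  let ?P = "{x \<in> carrier R. x [^] ?q \<in> ?J}"
  have mult: "a \<otimes> x \<in> ?P" if "a \<in> carrier R" "x \<in> ?P" for a x
    using that ideal.I_l_closed[OF J, of "x [^] ?q" "a [^] ?q"] by (simp add: nat_pow_distrib)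
  have "\<zero> [^] ?q = \<zero>" using q0 by (metis nat_pow_zero less_not_refl)
  then have "subsp ?P"
    using subspD(2,3)[OF Jsub] mult A_closed freshmans_dream[OF p] by (intro subspI) auto
  then have "ideal ?P R"
  proof (intro idealI[OF ring_axioms])
    fix a x assume ax: "a \<in> ?P" "x \<in> carrier R"
    show l: "x \<otimes> a \<in> ?P" by (rule mult[OF ax(2,1)])
    have "a \<otimes> x = x \<otimes> a" using ax by (intro m_comm) auto
    then show "a \<otimes> x \<in> ?P" using l by (simp only:)
  qed (rule subalgebra.axioms(1))
  moreover have "f ` {1..d} \<subseteq> ?P" using f genideal_self[OF fq] by auto
  ultimately have "?I \<subseteq> ?P" by (rule genideal_minimal)
  then have "{x [^] ?q | x. x \<in> ?I} \<subseteq> ?J" by blast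
  then have 1: "Idl {x [^] ?q | x. x \<in> ?I} \<subseteq> ?J" by (rule genideal_minimal[OF J])
  have c: "{x [^] ?q | x. x \<in> ?I} \<subseteq> carrier R" using Ic by auto
  have "(\<lambda>i. f i [^] ?q) ` {1..d} \<subseteq> {x [^] ?q | x. x \<in> ?I}" using genideal_self[OF f] by blast
  also have "\<dots> \<subseteq> Idl {x [^] ?q | x. x \<in> ?I}" by (rule genideal_self[OF c])
  finally have "?J \<subseteq> Idl {x [^] ?q | x. x \<in> ?I}"
    by (rule genideal_minimal[OF genideal_ideal[OF c]])
  with 1 show ?thesis unfolding frobenius_power_def by blast
qed

end

section \<open>Standard monomials of an algebra over its parameters\<close>

text \<open>A position-over-term order: compare the generators first, then the exponents lexicographically. What
  matters is that it is total on exponent vectors and invariant under multiplication by monomials.\<close>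

definition mono_less :: "nat \<times> (nat \<Rightarrow> nat) \<Rightarrow> nat \<times> (nat \<Rightarrow> nat) \<Rightarrow> bool" where
  "mono_less x y \<longleftrightarrow> fst x < fst y \<or> fst x = fst y \<and> less_fun (snd x) (snd y)"

lemma transp_mono_less: "transp mono_less"
  by (rule transpI) (auto simp: mono_less_def intro: less_fun_trans)

lemma asymp_mono_less: "asymp mono_less"
  by (rule asympI) (auto simp: mono_less_def dest: less_fun_asym)

lemma totalp_on_mono_less:
  assumes "snd ` S \<subseteq> exponents d"
  shows "totalp_on S mono_less"
proof (rule totalp_onI)
  fix x y assume "x \<in> S" "y \<in> S" and neq: "x \<noteq> y"
  then have xy: "snd x \<in> exponents d" "snd y \<in> exponents d" using assms by auto
  have "finite {k. snd x k \<noteq> snd y k}"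
    by (rule finite_subset[of _ "{1..d}"]) (use xy in \<open>unfold exponents_def, force\<close>)+
  from less_fun_trichotomy[OF this] show "mono_less x y \<or> mono_less y x"
    using neq by (auto simp: mono_less_def prod_eq_iff)
qed

lemma mono_less_shift: "mono_less (l, b) (l', b') \<Longrightarrow> mono_less (l, \<lambda>i. b i + c i) (l', \<lambda>i. b' i + c i)"
  by (auto simp: mono_less_def less_fun_def)

locale parameter_algebra = graded_algebra R A for R (structure) and A +
  fixes d m :: nat and f u :: "nat \<Rightarrow> 'a" and \<delta> e :: "nat \<Rightarrow> nat"
  assumes f_A: "\<And>i. i \<in> {1..d} \<Longrightarrow> f i \<in> A (\<delta> i)"
    and \<delta>_pos: "\<And>i. i \<in> {1..d} \<Longrightarrow> \<delta> i > 0"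
    and u_A: "\<And>l. l < m \<Longrightarrow> u l \<in> A (e l)"
    and generate: "\<And>j. A j \<subseteq> lin_span {monomial d f b \<otimes> u l | l b. l < m \<and> b \<in> exponents d \<and> weight \<delta> d b + e l = j}"
begin

definition gen_vec :: "nat \<times> (nat \<Rightarrow> nat) \<Rightarrow> 'a" where
  "gen_vec x = monomial d f (snd x) \<otimes> u (fst x)"

definition indices :: "nat \<Rightarrow> (nat \<times> (nat \<Rightarrow> nat)) set" where
  "indices j = {x. fst x < m \<and> snd x \<in> exponents d \<and> weight \<delta> d (snd x) + e (fst x) = j}"

lemma f_carrier: "f ` {1..d} \<subseteq> carrier R"
  by (rule gens_carrier[OF f_A])

lemma finite_indices: "finite (indices j)"
proof (rule finite_subset)
  show "indices j \<subseteq> {..<m} \<times> {b \<in> exponents d. weight \<delta> d b \<le> j}" by (auto simp: indices_def)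
  show "finite ({..<m} \<times> {b \<in> exponents d. weight \<delta> d b \<le> j})"
    by (intro finite_cartesian_product finite_lessThan finite_weight_le[OF \<delta>_pos])
qed

lemma gen_vec_A: "x \<in> indices j \<Longrightarrow> gen_vec x \<in> A j"
  unfolding gen_vec_def indices_def using piece_mult[OF monomial_A[OF f_A] u_A] by auto

lemma gen_vec_indices_carrier: "gen_vec ` indices j \<subseteq> carrier R"
  using gen_vec_A A_closed by blast

lemma A_eq_lin_span: "A j = lin_span (gen_vec ` indices j)"
proof
  have "{monomial d f b \<otimes> u l | l b. l < m \<and> b \<in> exponents d \<and> weight \<delta> d b + e l = j} \<subseteq> gen_vec ` indices j"
    by (force simp: gen_vec_def indices_def image_iff)
  then have "lin_span {monomial d f b \<otimes> u l | l b. l < m \<and> b \<in> exponents d \<and> weight \<delta> d b + e l = j} \<subseteq> lin_span (gen_vec ` indices j)"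
    by (rule hull_mono)
  then show "A j \<subseteq> lin_span (gen_vec ` indices j)" using generate[of j] by simp
  show "lin_span (gen_vec ` indices j) \<subseteq> A j" by (rule lin_span_subset_A) (use gen_vec_A in blast)
qed

lemma gen_vec_shift:
  assumes "x \<in> indices j"
  shows "gen_vec (fst x, \<lambda>i. snd x i + c i) = monomial d f c \<otimes> gen_vec x"
proof -
  have "u (fst x) \<in> carrier R" using assms u_A A_closed by (auto simp: indices_def)
  then show ?thesis
    using monomial_carrier[OF f_carrier] by (simp add: gen_vec_def monomial_add[OF f_carrier] m_ac)
qed

lemma indices_shift: "\<lbrakk>x \<in> indices j; c \<in> exponents d\<rbrakk> \<Longrightarrow> (fst x, \<lambda>i. snd x i + c i) \<in> indices (j + weight \<delta> d c)"
  by (auto simp: indices_def weight_add exponents_def)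

definition std_monomials :: "(nat \<times> (nat \<Rightarrow> nat)) set" where
  "std_monomials = (\<Union>j. standard mono_less gen_vec (indices j))"

lemma std_monomials_iff: "x \<in> indices j \<Longrightarrow> x \<in> std_monomials \<longleftrightarrow> gen_vec x \<notin> lin_span (gen_vec ` {y \<in> indices j. mono_less y x})"
  unfolding std_monomials_def standard_def by (auto simp: indices_def)

lemma std_monomials_degree: "{x \<in> std_monomials. weight \<delta> d (snd x) + e (fst x) = j} = standard mono_less gen_vec (indices j)"
  unfolding std_monomials_def standard_def by (auto simp: indices_def)

text \<open>If a monomial is a combination of smaller ones, then multiplying this relation by a further monomial shows the
  same for the product.\<close>

lemma std_monomials_downward:
  assumes "(l, \<lambda>i. b i + c i) \<in> std_monomials" "b \<in> exponents d" "c \<in> exponents d"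
  shows "(l, b) \<in> std_monomials"
proof (rule ccontr)
  assume no: "(l, b) \<notin> std_monomials"
  define j where "j = weight \<delta> d b + e l"
  have "l < m" using assms(1) by (auto simp: std_monomials_def standard_def indices_def)
  then have lb: "(l, b) \<in> indices j" using assms(2) by (simp add: indices_def j_def)
  let ?less = "{y \<in> indices j. mono_less y (l, b)}"
  have less_c: "gen_vec ` ?less \<subseteq> carrier R" using gen_vec_A A_closed by blast
  have "gen_vec (l, b) \<in> lin_span (gen_vec ` ?less)" using no std_monomials_iff[OF lb] by simp
  then have "monomial d f c \<otimes> gen_vec (l, b) \<in> lin_span ((\<otimes>) (monomial d f c) ` gen_vec ` ?less)"
    by (rule mult_lin_span[OF monomial_carrier[OF f_carrier] less_c])
  also have "\<dots> \<subseteq> lin_span (gen_vec ` {y \<in> indices (j + weight \<delta> d c). mono_less y (l, \<lambda>i. b i + c i)})"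
  proof (rule hull_mono, unfold image_image, rule image_subsetI)
    fix y assume y: "y \<in> ?less"
    let ?y = "(fst y, \<lambda>i. snd y i + c i)"
    have "?y \<in> {y \<in> indices (j + weight \<delta> d c). mono_less y (l, \<lambda>i. b i + c i)}"
      using y indices_shift[OF _ assms(3)] mono_less_shift[of "fst y" "snd y" l b c] by simp
    moreover have "monomial d f c \<otimes> gen_vec y = gen_vec ?y" using gen_vec_shift[of y j c] y by simp
    ultimately show "monomial d f c \<otimes> gen_vec y \<in> gen_vec ` {y \<in> indices (j + weight \<delta> d c). mono_less y (l, \<lambda>i. b i + c i)}"
      by blast
  qed
  also have "monomial d f c \<otimes> gen_vec (l, b) = gen_vec (l, \<lambda>i. b i + c i)" using gen_vec_shift[OF lb, of c] by simp
  finally show False using assms(1) std_monomials_iff[OF indices_shift[OF lb assms(3)]] by simp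
qed

sublocale staircase d m \<delta> e std_monomials
proof
  show "\<And>i. i \<in> {1..d} \<Longrightarrow> \<delta> i > 0" by (rule \<delta>_pos)
  show "l < m \<and> b \<in> exponents d" if "(l, b) \<in> std_monomials" for l b
    using that by (auto simp: std_monomials_def standard_def indices_def)
qed (rule std_monomials_downward)

lemma standard_indices_facts:
  "transp mono_less" "asymp mono_less" "totalp_on (indices j) mono_less"
  by (rule transp_mono_less asymp_mono_less totalp_on_mono_less[of _ d])+ (auto simp: indices_def)

lemma rel_length_piece: "rel_length {\<zero>} (A j) = enat (hilbert j)"
  unfolding hilbert_def std_monomials_degree
  by (rule trans[OF arg_cong[where f = "rel_length {\<zero>}", OF A_eq_lin_span]
        rel_length_zero_eq_card_standard[OF finite_indices gen_vec_indices_carrier standard_indices_facts]])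

lemma A_eq_lin_span_std_monomials: "A j = lin_span (gen_vec ` standard mono_less gen_vec (indices j))"
  by (rule trans[OF A_eq_lin_span standard_chain(1)[OF finite_indices gen_vec_indices_carrier standard_indices_facts, symmetric]])

definition power_ideal :: "nat \<Rightarrow> 'a set" where
  "power_ideal q = Idl ((\<lambda>i. f i [^] q) ` {1..d})"

definition quotient_hilbert :: "nat \<Rightarrow> nat \<Rightarrow> nat" where
  "quotient_hilbert q j = the_enat (rel_length (power_ideal q \<inter> A j) (A j))"

lemma f_power_A: "i \<in> {1..d} \<Longrightarrow> f i [^] (q::nat) \<in> A (\<delta> i * q)"
  by (intro pow_A f_A)

lemma power_ideal: "ideal (power_ideal q) R"
  unfolding power_ideal_def by (intro genideal_ideal gens_carrier[OF f_power_A])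

lemma large_exponent_in_power_ideal:
  assumes "x \<in> indices j" "i \<in> {1..d}" "q \<le> snd x i"
  shows "gen_vec x \<in> power_ideal q"
proof -
  let ?c = "\<lambda>k. if k = i then q else 0" and ?b = "\<lambda>k. snd x k - (if k = i then q else 0)"
  have "snd x = (\<lambda>k. ?b k + ?c k)" using assms(3) by auto
  then have "monomial d f (snd x) = monomial d f ?b \<otimes> monomial d f ?c" using monomial_add[OF f_carrier, of ?b ?c] by simp
  also have "monomial d f ?c = f i [^] q" by (rule monomial_single[OF f_carrier assms(2)])
  finally have eq: "gen_vec x = (monomial d f ?b \<otimes> f i [^] q) \<otimes> u (fst x)" by (simp add: gen_vec_def)
  have "(\<lambda>i. f i [^] q) ` {1..d} \<subseteq> power_ideal q"
    unfolding power_ideal_def by (intro genideal_self gens_carrier[OF f_power_A])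
  then have "f i [^] q \<in> power_ideal q" using assms(2) by blast
  moreover have "u (fst x) \<in> carrier R" using assms(1) u_A A_closed by (auto simp: indices_def)
  ultimately show ?thesis
    unfolding eq by (intro ideal.I_r_closed[OF power_ideal] ideal.I_l_closed[OF power_ideal] monomial_carrier[OF f_carrier])
qed

text \<open>Standard monomials span the piece, and those with an exponent at least \<open>q\<close> vanish in the quotient.\<close>

lemma rel_length_power_ideal_le: "rel_length (power_ideal q \<inter> A j) (A j) \<le> enat (truncated_hilbert q j)"
proof -
  let ?S = "{x \<in> standard mono_less gen_vec (indices j). snd x \<in> exponent_box d (\<lambda>_. q)}"
  have S: "?S = {x \<in> std_monomials. deg x = j \<and> snd x \<in> exponent_box d (\<lambda>_. q)}"
    using std_monomials_degree[of j] by blast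
  have fin: "finite ?S" using finite_indices[of j] by (auto simp: standard_def)
  have indices: "standard mono_less gen_vec (indices j) \<subseteq> indices j" by (auto simp: standard_def)
  let ?T = "(power_ideal q \<inter> A j) \<union> gen_vec ` ?S"
  have Tc: "?T \<subseteq> carrier R" using A_carrier[of j] gen_vec_indices_carrier[of j] indices by blast
  have "gen_vec ` standard mono_less gen_vec (indices j) \<subseteq> ?T"
  proof (rule image_subsetI)
    fix x assume x: "x \<in> standard mono_less gen_vec (indices j)"
    then have xi: "x \<in> indices j" using indices by blast
    show "gen_vec x \<in> ?T"
    proof (cases "snd x \<in> exponent_box d (\<lambda>_. q)")
      case True then show ?thesis using x by blast
    next
      case False
      then obtain i where "i \<in> {1..d}" "q \<le> snd x i" using xi by (auto simp: exponent_box_def indices_def not_less)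
      then show ?thesis using large_exponent_in_power_ideal[OF xi] gen_vec_A[OF xi] by blast
    qed
  qed
  then have "A j \<subseteq> lin_span ?T" unfolding A_eq_lin_span_std_monomials[of j] by (rule hull_mono)
  then have "rel_length (power_ideal q \<inter> A j) (A j) \<le> enat (card (gen_vec ` ?S))"
    using fin Tc by (intro rel_length_le_card) auto
  also have "\<dots> \<le> enat (truncated_hilbert q j)"
    using card_image_le[OF fin, of gen_vec] unfolding truncated_hilbert_def S by simp
  finally show ?thesis .
qed

lemma rel_length_power_ideal: "rel_length (power_ideal q \<inter> A j) (A j) = enat (quotient_hilbert q j)"
  unfolding quotient_hilbert_def using rel_length_power_ideal_le[of q j]
  by (metis enat_ile the_enat.simps)

lemma quotient_hilbert_le: "quotient_hilbert q j \<le> truncated_hilbert q j"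
  using rel_length_power_ideal_le[of q j] unfolding rel_length_power_ideal by simp

text \<open>Apply \<open>graded_Nakayama\<close> to the elements \<open>f_i^q\<close>: homogeneous lifts of bases of the pieces of the quotient
  span \<open>R\<close> over the monomials in the \<open>f_i^q\<close>.\<close>

lemma hilbert_tiling:
  assumes q: "q > 0"
  shows "hilbert j \<le> (\<Sum>c | c \<in> exponents d \<and> q * weight \<delta> d c \<le> j. quotient_hilbert q (j - q * weight \<delta> d c))"
proof -
  let ?g = "\<lambda>i. f i [^] q" and ?e = "\<lambda>i. \<delta> i * q"
  have weight: "weight ?e d c = q * weight \<delta> d c" for c
    unfolding weight_def sum_distrib_left by (rule sum.cong) auto
  have piece: "power_ideal q \<inter> A j = lin_span (multiples d ?g ?e j)" for j
    unfolding power_ideal_def by (rule ideal_piece[OF f_power_A])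
  have "\<exists>W. finite W \<and> W \<subseteq> A j \<and> card W \<le> quotient_hilbert q j \<and> A j \<subseteq> lin_span (W \<union> multiples d ?g ?e j)" for j
  proof -
    have "\<exists>W. finite W \<and> W \<subseteq> A j \<and> card W \<le> quotient_hilbert q j \<and> A j \<subseteq> lin_span ((power_ideal q \<inter> A j) \<union> W)"
      by (rule rel_length_spanning_set)
         (auto simp: rel_length_power_ideal intro: subsp_Int subsp_ideal power_ideal subsp_A)
    moreover have "lin_span ((power_ideal q \<inter> A j) \<union> W) = lin_span (W \<union> multiples d ?g ?e j)" for W
      unfolding piece by (metis hull_Un_left sup.commute)
    ultimately show ?thesis by metis
  qed
  then obtain W where W: "\<And>j. finite (W j)" "\<And>j. W j \<subseteq> A j" "\<And>j. card (W j) \<le> quotient_hilbert q j"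
    "\<And>j. A j \<subseteq> lin_span (W j \<union> multiples d ?g ?e j)"
    by metis
  let ?C = "{c \<in> exponents d. q * weight \<delta> d c \<le> j}"
  let ?T = "{monomial d ?g c \<otimes> w | c w. c \<in> exponents d \<and> weight ?e d c \<le> j \<and> w \<in> W (j - weight ?e d c)}"
  let ?P = "SIGMA c:?C. W (j - q * weight \<delta> d c)"
  have finC: "finite ?C"
  proof (rule finite_subset[OF _ finite_weight_le[OF \<delta>_pos]])
    show "?C \<subseteq> {c \<in> exponents d. weight \<delta> d c \<le> j}"
    proof clarify
      fix c assume "q * weight \<delta> d c \<le> j"
      moreover have "weight \<delta> d c \<le> q * weight \<delta> d c" using q by (cases q) auto
      ultimately show "weight \<delta> d c \<le> j" by (rule order_trans[rotated])
    qed
  qed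
  have T: "?T = (\<lambda>(c, w). monomial d ?g c \<otimes> w) ` ?P" unfolding weight by auto
  have finP: "finite ?P" using finC W(1) by blast
  have gc: "?g ` {1..d} \<subseteq> carrier R" using f_carrier by auto
  have Tc: "?T \<subseteq> carrier R"
  proof clarify
    fix c w assume "w \<in> W (j - weight ?e d c)"
    then have "w \<in> carrier R" using W(2) A_closed by blast
    then show "monomial d ?g c \<otimes> w \<in> carrier R" using monomial_carrier[OF gc] by (rule m_closed[rotated])
  qed
  have "A j \<subseteq> lin_span ?T"
    by (rule graded_Nakayama[OF f_power_A _ W(2,4)]) (use \<delta>_pos q in auto)
  also have "\<dots> \<subseteq> lin_span ({\<zero>} \<union> ?T)" by (rule hull_mono) auto
  finally have "rel_length {\<zero>} (A j) \<le> enat (card ?T)"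
    using Tc finP by (intro rel_length_le_card) (simp_all add: T)
  then have "hilbert j \<le> card ?T" unfolding rel_length_piece by simp
  also have "\<dots> \<le> card ?P" unfolding T by (rule card_image_le[OF finP])
  also have "\<dots> = (\<Sum>c\<in>?C. card (W (j - q * weight \<delta> d c)))"
    using finC W(1) by (intro card_SigmaI) auto
  also have "\<dots> \<le> (\<Sum>c\<in>?C. quotient_hilbert q (j - q * weight \<delta> d c))" by (intro sum_mono W(3))
  finally show ?thesis .
qed

text \<open>If a parameter vanishes, no monomial that involves it is standard, and every column is incomplete.\<close>

lemma generic_rank_eq_0:
  assumes "i \<in> {1..d}" "f i = \<zero>"
  shows "generic_rank = 0"
proof -
  have "l \<notin> full_columns" for l
  proof
    assume l: "l \<in> full_columns"
    let ?c = "\<lambda>k. if k = i then 1 else 0 :: nat"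
    have c: "?c \<in> exponents d" using assms(1) by (auto simp: exponents_def)
    then have std_monomials: "(l, ?c) \<in> std_monomials" using l by (auto simp: full_columns_def)
    have indices: "(l, ?c) \<in> indices (weight \<delta> d ?c + e l)" using c l by (auto simp: indices_def full_columns_def)
    have "monomial d f ?c = \<zero>" using monomial_single[OF f_carrier assms(1), of 1] assms(2) by simp
    then have "gen_vec (l, ?c) = \<zero>" using u_A[of l] A_closed l by (auto simp: gen_vec_def full_columns_def)
    moreover have "\<zero> \<in> lin_span (gen_vec ` {y \<in> indices (weight \<delta> d ?c + e l). mono_less y (l, ?c)})"
      using gen_vec_indices_carrier by (intro subspD(2) subsp_lin_span) blast
    ultimately show False using std_monomials std_monomials_iff[OF indices] by simp
  qed
  then have "full_columns = {}" by blast
  then show ?thesis by (simp add: generic_rank_def)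
qed

section \<open>The Frobenius-Poincare function of a parameter ideal\<close>

lemma multiplicity:
  assumes "krull_dim R = enat d"
  shows "hilbert_samuel_multiplicity R A = real generic_rank / real (\<Prod>i\<in>{1..d}. \<delta> i)"
proof -
  have eq: "1 / real n ^ d * (\<Sum>j\<le>n. real (hilbert j)) = real (\<Sum>j\<le>n. hilbert j) / real n ^ d" for n
    by simp
  have "lim (\<lambda>n. 1 / real n ^ d * (\<Sum>j\<le>n. real (hilbert j))) = real generic_rank / (fact d * real (\<Prod>i\<in>{1..d}. \<delta> i))"
    unfolding eq by (rule limI[OF sum_hilbert_limit])
  then show ?thesis
    unfolding hilbert_samuel_multiplicity_def assms module_length_piece rel_length_piece
    by (simp add: Let_def)
qed

lemma frobenius_poincare_value:
  assumes "ring_char (R\<lparr>carrier := A 0\<rparr>) = p" "p > 0" "krull_dim R = enat d"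
  shows "frobenius_poincare R A p (Idl (f ` {1..d})) y = of_nat generic_rank *
    (\<Prod>i\<in>{1..d}. if y = 0 then 1 else (1 - exp (- \<i> * of_nat (\<delta> i) * y)) / (\<i> * of_nat (\<delta> i) * y))"
    (is "_ = ?L")
proof -
  note p = ring_char_prime[OF assms(1,2)]
  have len: "module_length (degree_zero_ring R A) (quot_piece R A (frobenius_power R (Idl (f ` {1..d})) (p ^ n)) j)
      = enat (quotient_hilbert (p ^ n) j)" for n j
    unfolding frobenius_power_generators[OF p f_carrier] power_ideal_def[symmetric]
      module_length_quot_piece[OF power_ideal] by (rule rel_length_power_ideal)
  let ?s = "\<lambda>q. (1 / of_nat q) ^ d * suminf (\<lambda>j. of_nat (quotient_hilbert q j) * exp (- \<i> * y * of_nat j / of_nat q))"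
  have "?s \<longlonglongrightarrow> ?L"
    by (rule scaled_exponential_sum_limit) (use quotient_hilbert_le hilbert_tiling in auto)
  moreover have "filterlim (\<lambda>n. p ^ n) sequentially sequentially"
    using prime_gt_1_nat[OF p(1)] by (intro filterlim_subseq strict_monoI power_strict_increasing) auto
  ultimately have "(\<lambda>n. ?s (p ^ n)) \<longlonglongrightarrow> ?L" by (rule filterlim_compose)
  from limI[OF this] show ?thesis
    unfolding frobenius_poincare_def assms(3) len by simp
qed

end

text \<open>Finite length bounds the dimension of each piece of the quotient and makes all but finitely many of them
  vanish, so lifts of bases form a finite set, to which \<open>graded_Nakayama\<close> applies.\<close>

lemma (in graded_algebra) finite_length_imp_parameter_algebra:
  assumes f: "\<And>i. i \<in> {1..d} \<Longrightarrow> f i \<in> A (\<delta> i)" and \<delta>: "\<And>i. i \<in> {1..d} \<Longrightarrow> \<delta> i > 0"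
    and len: "module_length R (quot_module R (Idl (f ` {1..d}))) \<noteq> \<infinity>"
  shows "\<exists>m u e. parameter_algebra R A d m f u \<delta> e"
proof -
  let ?J = "Idl (f ` {1..d})"
  have J: "ideal ?J R" by (intro genideal_ideal gens_carrier[OF f])
  have J_component: "component x n \<in> ?J" if "x \<in> ?J" for x n by (rule component_in_ideal[OF f that])
  obtain n0 where n0: "\<And>j. j \<ge> n0 \<Longrightarrow> A j \<subseteq> ?J"
    using eventually_piece_in_ideal[OF J J_component len] by blast
  obtain N where N: "module_length R (quot_module R ?J) = enat N" using len by auto
  have piece: "?J \<inter> A j = lin_span (multiples d f \<delta> j)" for j by (rule ideal_piece[OF f])
  have "\<exists>W. finite W \<and> W \<subseteq> A j \<and> (j \<ge> n0 \<longrightarrow> W = {}) \<and> A j \<subseteq> lin_span (W \<union> multiples d f \<delta> j)" for j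
  proof (cases "j \<ge> n0")
    case True
    then have "A j \<subseteq> lin_span (multiples d f \<delta> j)" using n0[OF True] piece[of j] by blast
    then show ?thesis by (intro exI[of _ "{}"]) simp
  next
    case False
    have "\<exists>W. finite W \<and> W \<subseteq> A j \<and> card W \<le> N \<and> A j \<subseteq> lin_span ((?J \<inter> A j) \<union> W)"
    proof (rule rel_length_spanning_set)
      show "rel_length (?J \<inter> A j) (A j) \<le> enat N" using rel_length_le_module_length[OF J J_component, of j] N by simp
      show "subsp (?J \<inter> A j)" by (rule subsp_Int[OF subsp_ideal[OF J] subsp_A])
    qed (auto intro: subsp_A)
    moreover have "lin_span ((?J \<inter> A j) \<union> W) = lin_span (W \<union> multiples d f \<delta> j)" for W
      unfolding piece by (metis hull_Un_left sup.commute)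
    ultimately show ?thesis using False by metis
  qed
  then obtain W where W: "\<And>j. finite (W j)" "\<And>j. W j \<subseteq> A j" "\<And>j. j \<ge> n0 \<Longrightarrow> W j = {}"
    "\<And>j. A j \<subseteq> lin_span (W j \<union> multiples d f \<delta> j)"
    by metis
  let ?L = "SIGMA j:{..<n0}. W j"
  have "finite ?L" using W(1) by blast
  then obtain h where h: "bij_betw h {0..<card ?L} ?L" using ex_bij_betw_nat_finite by blast
  have "parameter_algebra R A d (card ?L) f (\<lambda>l. snd (h l)) \<delta> (\<lambda>l. fst (h l))"
  proof (intro parameter_algebra.intro parameter_algebra_axioms.intro graded_algebra_axioms f \<delta>)
    show "snd (h l) \<in> A (fst (h l))" if "l < card ?L" for l
    proof -
      have "h l \<in> ?L" using bij_betwE[OF h] that by simp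
      then obtain j w where jw: "h l = (j, w)" "w \<in> W j" by auto
      then have "w \<in> A j" using W(2)[of j] by blast
      then show ?thesis using jw(1) by simp
    qed
    fix j
    let ?S = "{monomial d f b \<otimes> snd (h l) | l b. l < card ?L \<and> b \<in> exponents d \<and> weight \<delta> d b + fst (h l) = j}"
    have "A j \<subseteq> lin_span {monomial d f c \<otimes> w | c w. c \<in> exponents d \<and> weight \<delta> d c \<le> j \<and> w \<in> W (j - weight \<delta> d c)}"
      by (rule graded_Nakayama[OF f \<delta> W(2,4)])
    also have "\<dots> \<subseteq> lin_span ?S"
    proof (rule hull_mono, clarify)
      fix c w assume cw: "c \<in> exponents d" "weight \<delta> d c \<le> j" "w \<in> W (j - weight \<delta> d c)"
      then have "(j - weight \<delta> d c, w) \<in> ?L" using W(3)[of "j - weight \<delta> d c"] by (cases "j - weight \<delta> d c < n0") auto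
      then obtain l where "l < card ?L" "h l = (j - weight \<delta> d c, w)"
        using bij_betw_imp_surj_on[OF h] by (metis (no_types, lifting) atLeastLessThan_iff imageE)
      then show "\<exists>l b. monomial d f c \<otimes> w = monomial d f b \<otimes> snd (h l) \<and> l < card ?L \<and> b \<in> exponents d \<and> weight \<delta> d b + fst (h l) = j"
        using cw by (intro exI[of _ l] exI[of _ c]) simp
    qed
    finally show "A j \<subseteq> lin_span ?S" .
  qed
  then show ?thesis by blast
qed

lemma (in graded_algebra) frobenius_poincare_unit_ideal:
  assumes p: "p > 0" and unit: "Idl F = carrier R"
  shows "frobenius_poincare R A p (Idl F) y = 0"
proof -
  have "frobenius_power R (Idl F) q = carrier R" for q
  proof -
    have c: "{x [^] q | x. x \<in> carrier R} \<subseteq> carrier R" by auto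
    have "\<one> \<in> {x [^] q | x. x \<in> carrier R}" by (auto intro!: exI[of _ \<one>])
    then have "\<one> \<in> Idl {x [^] q | x. x \<in> carrier R}" using genideal_self[OF c] by blast
    then show ?thesis unfolding frobenius_power_def unit by (rule ideal.one_imp_carrier[OF genideal_ideal[OF c]])
  qed
  moreover have "rel_length (carrier R \<inter> A j) (A j) = 0" for j
  proof -
    have "carrier R \<inter> A j = A j" using A_carrier by blast
    moreover have "rel_length (A j) (A j) \<le> enat (card ({} :: 'a set))"
      by (rule rel_length_le_card) (auto simp: A_closed hull_inc)
    ultimately show ?thesis by (simp add: zero_enat_def[symmetric])
  qed
  ultimately show ?thesis
    unfolding frobenius_poincare_def
    by (simp add: module_length_quot_piece[OF oneideal] zero_enat_def the_enat.simps limI)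
qed

lemma remove_sings_factor:
  assumes "n > 0"
  shows "remove_sings (\<lambda>z. (1 - exp (- \<i> * of_nat n * z)) / (\<i> * z)) y =
    of_nat n * (if y = 0 then 1 else (1 - exp (- \<i> * of_nat n * y)) / (\<i> * of_nat n * y))"
proof (rule remove_sings_eqI, cases "y = 0")
  case True
  have "((\<lambda>z. 1 - exp (- \<i> * of_nat n * z)) has_field_derivative \<i> * of_nat n) (at 0)"
    by (auto intro!: derivative_eq_intros)
  then have "((\<lambda>z. (1 - exp (- \<i> * of_nat n * z)) / z) \<longlongrightarrow> \<i> * of_nat n) (at 0)"
    by (simp add: has_field_derivative_iff)
  then have "((\<lambda>z. (1 - exp (- \<i> * of_nat n * z)) / z / \<i>) \<longlongrightarrow> \<i> * of_nat n / \<i>) (at 0)"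
    by (intro tendsto_intros) auto
  moreover have "(\<lambda>z. (1 - exp (- \<i> * of_nat n * z)) / z / \<i>) = (\<lambda>z. (1 - exp (- \<i> * of_nat n * z)) / (\<i> * z))"
    by (rule ext) (simp only: divide_divide_eq_left mult.commute)
  moreover have "\<i> * of_nat n / \<i> = of_nat n * (if y = 0 then 1 else (1 - exp (- \<i> * of_nat n * y)) / (\<i> * of_nat n * y))"
    using True by simp
  ultimately show "((\<lambda>z. (1 - exp (- \<i> * of_nat n * z)) / (\<i> * z)) \<longlongrightarrow>
      of_nat n * (if y = 0 then 1 else (1 - exp (- \<i> * of_nat n * y)) / (\<i> * of_nat n * y))) (at y)"
    using True by (simp only:)
next
  case False
  have "((\<lambda>z. (1 - exp (- \<i> * of_nat n * z)) / (\<i> * z)) \<longlongrightarrow> (1 - exp (- \<i> * of_nat n * y)) / (\<i> * y)) (at y)"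
    using False by (intro tendsto_intros) auto
  moreover have "(1 - exp (- \<i> * of_nat n * y)) / (\<i> * y) =
      of_nat n * (if y = 0 then 1 else (1 - exp (- \<i> * of_nat n * y)) / (\<i> * of_nat n * y))"
    using False assms by simp
  ultimately show "((\<lambda>z. (1 - exp (- \<i> * of_nat n * z)) / (\<i> * z)) \<longlongrightarrow>
      of_nat n * (if y = 0 then 1 else (1 - exp (- \<i> * of_nat n * y)) / (\<i> * of_nat n * y))) (at y)"
    by simp
qed

lemma remove_sings_factor_0: "remove_sings (\<lambda>z. (1 - exp (- \<i> * of_nat 0 * z)) / (\<i> * z)) y = 0"
  by (rule remove_sings_eqI) simp

text \<open>The arguments above need parameters of positive degree. A parameter of degree \<open>0\<close> lies in the field \<open>R_0\<close>. If it
  is nonzero, the ideal is the whole ring and both sides vanish. If it is zero, it may be regarded as an element of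
  degree \<open>1\<close>; then the generic rank, and with it the left side, is \<open>0\<close>, and the factor belonging to the true
  degree makes the right side \<open>0\<close>.\<close>

theorem proposition4p5:
  fixes R k :: "('a, 'm) ring_scheme"
    and A :: "nat \<Rightarrow> 'a set"
    and p d :: nat
    and f :: "nat \<Rightarrow> 'a"
    and \<delta> :: "nat \<Rightarrow> nat"
    and I :: "'a set"
    and y :: complex
  assumes "field k" and "ring_char k = p" and "p > 0"
    and "nat_graded_ring R A" and "noetherian_ring R"
    and "degree_zero_ring R A = k"
    and "krull_dim R = enat d"
    and "homogeneous_sop R A d f \<delta>"
    and "I = Idl\<^bsub>R\<^esub> (f ` {1..d})"
  shows "frobenius_poincare R A p I y =
    of_real (hilbert_samuel_multiplicity R A) *
    (\<Prod>j\<in>{1..d}. remove_sings (\<lambda>z. (1 - exp (- \<i> * of_nat (\<delta> j) * z)) / (\<i> * z)) y)"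
proof -
  have k: "k = R\<lparr>carrier := A 0\<rparr>" using assms(6) by (simp add: degree_zero_ring_def)
  interpret graded_algebra R A
    using assms(1,4) unfolding k by (intro graded_algebra.intro graded_algebra_axioms.intro)
  have f: "f i \<in> A (\<delta> i)" if "i \<in> {1..d}" for i using assms(8) that by (simp add: homogeneous_sop_def)
  have len: "module_length R (quot_module R (Idl\<^bsub>R\<^esub> (f ` {1..d}))) \<noteq> \<infinity>"
    using assms(8) by (simp add: homogeneous_sop_def)
  let ?factor = "\<lambda>j. remove_sings (\<lambda>z. (1 - exp (- \<i> * of_nat (\<delta> j) * z)) / (\<i> * z)) y"
  have zero_prod: "(\<Prod>j\<in>{1..d}. ?factor j) = 0" if j: "j \<in> {1..d}" "\<delta> j = 0" for j
  proof -
    have "?factor j = 0" unfolding j(2) by (rule remove_sings_factor_0)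
    then show ?thesis using j(1) by (meson finite_atLeastAtMost prod_zero)
  qed
  show ?thesis
  proof (cases "\<exists>j\<in>{1..d}. \<delta> j = 0 \<and> f j \<noteq> \<zero>\<^bsub>R\<^esub>")
    case True
    then obtain j where j: "j \<in> {1..d}" "\<delta> j = 0" "f j \<noteq> \<zero>\<^bsub>R\<^esub>" by blast
    interpret F: field "R\<lparr>carrier := A 0\<rparr>" by (rule field_A0)
    have fj: "f j \<in> A 0" using f[OF j(1)] j(2) by simp
    then have "f j \<in> Units (R\<lparr>carrier := A 0\<rparr>)" using F.field_Units j(3) by simp
    then obtain g where g: "g \<in> A 0" "g \<otimes>\<^bsub>R\<^esub> f j = \<one>\<^bsub>R\<^esub>" unfolding Units_def by auto
    have fc: "f ` {1..d} \<subseteq> carrier R" by (rule gens_carrier[OF f])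
    have "f j \<in> Idl\<^bsub>R\<^esub> (f ` {1..d})" using genideal_self[OF fc] j(1) by blast
    then have "\<one>\<^bsub>R\<^esub> \<in> Idl\<^bsub>R\<^esub> (f ` {1..d})"
      using ideal.I_l_closed[OF genideal_ideal[OF fc] _ A_closed[OF g(1)]] g(2) by metis
    then have "Idl\<^bsub>R\<^esub> (f ` {1..d}) = carrier R" by (rule ideal.one_imp_carrier[OF genideal_ideal[OF fc]])
    then show ?thesis
      unfolding assms(9) zero_prod[OF j(1,2)] using frobenius_poincare_unit_ideal[OF assms(3)] by simp
  next
    case False
    \<comment> \<open>Zero lies in every piece, so a vanishing parameter can be given degree \<open>1\<close>.\<close>
    define \<epsilon> where "\<epsilon> i = (if \<delta> i = 0 then 1 else \<delta> i)" for i
    have f': "f i \<in> A (\<epsilon> i)" if "i \<in> {1..d}" for i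
    proof (cases "\<delta> i = 0")
      case True
      then have "f i = \<zero>\<^bsub>R\<^esub>" using False that by blast
      then show ?thesis using A_zero by simp
    qed (use f[OF that] in \<open>simp add: \<epsilon>_def\<close>)
    have "\<epsilon> i > 0" for i by (simp add: \<epsilon>_def)
    then obtain m u e where "parameter_algebra R A d m f u \<epsilon> e"
      using finite_length_imp_parameter_algebra[OF f' _ len] by blast
    then interpret parameter_algebra R A d m f u \<epsilon> e .
    let ?\<phi> = "\<lambda>i. if y = 0 then 1 else (1 - exp (- \<i> * of_nat (\<epsilon> i) * y)) / (\<i> * of_nat (\<epsilon> i) * y)"
    have F: "frobenius_poincare R A p I y = of_nat generic_rank * (\<Prod>i\<in>{1..d}. ?\<phi> i)"
      unfolding assms(9) using assms(2,3,7) unfolding k by (intro frobenius_poincare_value)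
    show ?thesis
    proof (cases "\<exists>j\<in>{1..d}. \<delta> j = 0")
      case True
      then obtain j where j: "j \<in> {1..d}" "\<delta> j = 0" by blast
      then have "generic_rank = 0" using False by (intro generic_rank_eq_0[OF j(1)]) blast
      then show ?thesis unfolding F zero_prod[OF j] by simp
    next
      case no_zero: False
      then have \<epsilon>: "\<epsilon> i = \<delta> i" if "i \<in> {1..d}" for i using that by (simp add: \<epsilon>_def)
      have "(\<Prod>j\<in>{1..d}. ?factor j) = (\<Prod>j\<in>{1..d}. of_nat (\<epsilon> j) * ?\<phi> j)"
      proof (rule prod.cong[OF refl])
        fix j assume j: "j \<in> {1..d}"
        then have "\<delta> j > 0" using no_zero by auto
        then show "?factor j = of_nat (\<epsilon> j) * ?\<phi> j" unfolding \<epsilon>[OF j] by (rule remove_sings_factor)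
      qed
      also have "\<dots> = of_nat (\<Prod>j\<in>{1..d}. \<epsilon> j) * (\<Prod>j\<in>{1..d}. ?\<phi> j)"
        by (simp add: prod.distrib)
      finally have P: "(\<Prod>j\<in>{1..d}. ?factor j) = of_nat (\<Prod>j\<in>{1..d}. \<epsilon> j) * (\<Prod>j\<in>{1..d}. ?\<phi> j)" .
      have pos: "(\<Prod>j\<in>{1..d}. \<epsilon> j) > 0" by (rule prod_pos) (auto simp: \<epsilon>_def)
      have cancel: "of_nat a * w = of_real (real a / real b) * (of_nat b * w)" if "b > 0" for a b :: nat and w :: complex
        using that by simp
      show ?thesis
        unfolding F P multiplicity[OF assms(7)] by (rule cancel[OF pos])
    qed
  qed
qed

end
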